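(* Let $\gamma(x,t)$ be a solution of the central affine curve flow $\gamma_t=\frac14q_x\gamma-\frac12q\gamma_x$ on $\mathbb{R}^2\setminus\{0\}$ with central affine curvature $q$, and let $E(x,t,\lambda)$ be an extended frame for $q$ with $E(0,0,0)=(\gamma,\gamma_x)$ at $(x,t)=(0,0)$. Given $k,\xi\in\mathbb{R}$ with $k\neq0$, let $$\begin{pmatrix} y_1(x,t) \\ y_2(x,t) \end{pmatrix}:=E(x,t,k^2)^{-1}\begin{pmatrix}-\xi\\1\end{pmatrix}.$$ Suppose $y_2(x,t)\neq0$ for all $(x,t)$ in an open set $\mathcal{O}\subset\mathbb{R}^2$, and set $\tilde\xi=-\frac{y_1}{y_2}$ on $\mathcal{O}$. Then, on $\mathcal{O}$, $$\tilde\gamma=\frac1k(\tilde\xi\gamma-\gamma_x)$$ is a solution of the central affine curve flow with central affine curvature $\tilde q=-q+2(\tilde\xi^2-k^2)$. Moreover, $$\tilde E(x,t,\lambda)=\frac{r_{\xi,k}(\lambda)\,E(x,t,\lambda)\,r_{-\tilde\xi(x,t),k}(\lambda)}{\lambda-k^2}$$ is an extended frame for $\tilde q$, where $r_{\xi,k}(\lambda)=\begin{pmatrix}\xi&\xi^2-k^2+\lambda\\1&\xi\end{pmatrix}$.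
   Context: A solution of the central affine curve flow $\gamma_t=\frac14q_x\gamma-\frac12q\gamma_x$ is a smooth map $\gamma(x,t)$ into $\mathbb{R}^2\setminus\{0\}$ (column vectors) with $\det(\gamma,\gamma_x)=1$ satisfying this equation, where $q(\cdot,t)$ is the central affine curvature of $\gamma(\cdot,t)$, i.e. the unique smooth function with $\gamma_{xx}=q\gamma$. The given solution $\gamma$ is defined for $(x,t)\in\mathbb{R}^2$. It is known that $q$ then solves the KdV equation $q_t=\frac14(q_{xxx}-6qq_x)$. An extended frame of a solution $q$ of the KdV equation is a solution $E(x,t,\lambda)\in SL(2,\mathbb{C})$, holomorphic in $\lambda\in\mathbb{C}$ and satisfying $\overline{E(x,t,\bar\lambda)}=E(x,t,\lambda)$, of $$E_x=E\begin{pmatrix}0&\lambda+q\\1&0\end{pmatrix},\qquad E_t=E\begin{pmatrix}\frac14q_x&\lambda^2+\frac12q\lambda+\frac14(q_{xx}-2q^2)\\ \lambda-\frac q2&-\frac14q_x\end{pmatrix}.$$ $(\gamma,\gamma_x)$ denotes the $2\times2$ matrix with columns $\gamma,\gamma_x$. *)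

theory Defs
  imports "HOL-Analysis.Analysis"
begin

text \<open>C^n functions on an open set. All iterated directional derivatives
  up to order n exist and are continuous, those of order less than n being Frechet differentiable.\<close>

primrec Ck_on :: "nat \<Rightarrow> 'a::real_normed_vector set \<Rightarrow> ('a \<Rightarrow> 'b::real_normed_vector) \<Rightarrow> bool" where
  "Ck_on 0 S f \<longleftrightarrow> continuous_on S f"
| "Ck_on (Suc n) S f \<longleftrightarrow>
     (\<forall>p\<in>S. f differentiable (at p)) \<and> (\<forall>v. Ck_on n S (\<lambda>p. frechet_derivative f (at p) v))"

definition smooth_on :: "'a::real_normed_vector set \<Rightarrow> ('a \<Rightarrow> 'b::real_normed_vector) \<Rightarrow> bool" where
  "smooth_on S f \<longleftrightarrow> (\<forall>n. Ck_on n S f)"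

text \<open>Points of the plane are pairs (x,t).\<close>

definition ddx :: "(real \<times> real \<Rightarrow> 'b::real_normed_vector) \<Rightarrow> real \<times> real \<Rightarrow> 'b" where
  "ddx f p = vector_derivative (\<lambda>x. f (x, snd p)) (at (fst p))"

definition ddt :: "(real \<times> real \<Rightarrow> 'b::real_normed_vector) \<Rightarrow> real \<times> real \<Rightarrow> 'b" where
  "ddt f p = vector_derivative (\<lambda>t. f (fst p, t)) (at (snd p))"

definition mat22 :: "'a \<Rightarrow> 'a \<Rightarrow> 'a \<Rightarrow> 'a \<Rightarrow> 'a::zero ^ 2 ^ 2" where
  "mat22 a b c d = vector [vector [a, b], vector [c, d]]"

definition col_mat :: "'a::zero ^ 2 \<Rightarrow> 'a ^ 2 \<Rightarrow> 'a ^ 2 ^ 2" where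
  "col_mat u v = mat22 (u $ 1) (v $ 1) (u $ 2) (v $ 2)"

text \<open>The curvature is determined on S by these conditions when the curve avoids the origin.\<close>

definition central_affine_curvature_on ::
  "(real \<times> real) set \<Rightarrow> (real \<times> real \<Rightarrow> real ^ 2) \<Rightarrow> (real \<times> real \<Rightarrow> real) \<Rightarrow> bool" where
  "central_affine_curvature_on S \<gamma> q \<longleftrightarrow>
     smooth_on S q \<and> (\<forall>p\<in>S. ddx (ddx \<gamma>) p = q p *\<^sub>R \<gamma> p)"

text \<open>A solution of the central affine curve flow on S, with central affine curvature q.\<close>

definition central_affine_curve_flow_on ::
  "(real \<times> real) set \<Rightarrow> (real \<times> real \<Rightarrow> real ^ 2) \<Rightarrow> (real \<times> real \<Rightarrow> real) \<Rightarrow> bool" where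
  "central_affine_curve_flow_on S \<gamma> q \<longleftrightarrow>
     smooth_on S \<gamma> \<and>
     (\<forall>p\<in>S. \<gamma> p \<noteq> 0) \<and>
     (\<forall>p\<in>S. det (col_mat (\<gamma> p) (ddx \<gamma> p)) = 1) \<and>
     central_affine_curvature_on S \<gamma> q \<and>
     (\<forall>p\<in>S. ddt \<gamma> p = (1/4 * ddx q p) *\<^sub>R \<gamma> p - (1/2 * q p) *\<^sub>R ddx \<gamma> p)"

definition KdV_on :: "(real \<times> real) set \<Rightarrow> (real \<times> real \<Rightarrow> real) \<Rightarrow> bool" where
  "KdV_on S q \<longleftrightarrow>
     smooth_on S q \<and>
     (\<forall>p\<in>S. ddt q p = 1/4 * (ddx (ddx (ddx q)) p - 6 * q p * ddx q p))"

definition lax_x :: "(real \<times> real \<Rightarrow> real) \<Rightarrow> real \<times> real \<Rightarrow> complex \<Rightarrow> complex ^ 2 ^ 2" where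
  "lax_x q p l = mat22 0 (l + of_real (q p)) 1 0"

definition lax_t :: "(real \<times> real \<Rightarrow> real) \<Rightarrow> real \<times> real \<Rightarrow> complex \<Rightarrow> complex ^ 2 ^ 2" where
  "lax_t q p l = mat22
     (of_real (1/4 * ddx q p))
     (l ^ 2 + of_real (1/2 * q p) * l + of_real (1/4 * (ddx (ddx q) p - 2 * (q p) ^ 2)))
     (l - of_real (q p / 2))
     (of_real (- (1/4) * ddx q p))"

text \<open>Extended frame of a KdV solution q on S. Smoothness in (x,t) is required for each fixed
  value of the spectral parameter, holomorphy (entrywise) for each fixed (x,t).\<close>

definition extended_frame_on ::
  "(real \<times> real) set \<Rightarrow> (real \<times> real \<Rightarrow> real) \<Rightarrow> (real \<times> real \<Rightarrow> complex \<Rightarrow> complex ^ 2 ^ 2) \<Rightarrow> bool" where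
  "extended_frame_on S q E \<longleftrightarrow>
     KdV_on S q \<and>
     (\<forall>l. smooth_on S (\<lambda>p. E p l)) \<and>
     (\<forall>p\<in>S. \<forall>l. det (E p l) = 1) \<and>
     (\<forall>p\<in>S. \<forall>i j. (\<lambda>l. E p l $ i $ j) holomorphic_on UNIV) \<and>
     (\<forall>p\<in>S. \<forall>l i j. cnj (E p (cnj l) $ i $ j) = E p l $ i $ j) \<and>
     (\<forall>p\<in>S. \<forall>l. ddx (\<lambda>p. E p l) p = E p l ** lax_x q p l) \<and>
     (\<forall>p\<in>S. \<forall>l. ddt (\<lambda>p. E p l) p = E p l ** lax_t q p l)"

definition r_mat :: "real \<Rightarrow> real \<Rightarrow> complex \<Rightarrow> complex ^ 2 ^ 2" where
  "r_mat \<xi> k l = mat22 (of_real \<xi>) (of_real (\<xi> ^ 2 - k ^ 2) + l) 1 (of_real \<xi>)"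

definition complexify :: "real ^ 2 ^ 2 \<Rightarrow> complex ^ 2 ^ 2" where
  "complexify M = (\<chi> i j. complex_of_real (M $ i $ j))"

end

theory Submission
  imports Defs "HOL-Complex_Analysis.Cauchy_Integral_Formula"
begin

text \<open>
  Write \<open>A\<close>, \<open>B\<close> for the Lax matrices of \<open>q\<close>, so that \<open>E_x = E A\<close> and \<open>E_t = E B\<close>, and let \<open>X\<close> stand for
  \<open>\<xi>t = - y1 / y2\<close>. Since \<open>det E = 1\<close>, the row vector \<open>(1, \<xi>) E\<close> at \<open>\<lambda> = k\<^sup>2\<close> is \<open>(v, w) = (y2, - y1)\<close>. It
  solves \<open>(v, w)_x = (v, w) A\<close> and \<open>(v, w)_t = (v, w) B\<close>, and it is real because \<open>E\<close> is real at real \<open>\<lambda>\<close>.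
  Its slope \<open>X = w / v\<close> is therefore a real smooth solution of a system of Riccati equations
  (\<open>riccati_solution\<close>), whose first equation is \<open>X_x = q + k\<^sup>2 - X\<^sup>2\<close>; consequently the new potential is
  \<open>Q = - q + 2 (X\<^sup>2 - k\<^sup>2) = q - 2 X_x\<close>. From the Riccati system and the KdV equation for \<open>q\<close> one computes
  the \<open>x\<close>-derivatives of \<open>Q\<close> and the KdV equation for \<open>Q\<close> (\<open>transformed_potential\<close>). In the same way
  the flow of the new curve follows once \<open>\<gamma>_xt = \<gamma>_tx\<close> has supplied the time derivative of \<open>\<gamma>_x\<close>
  (\<open>transformed_curve\<close>).

  For the frame, put \<open>R = r_mat (- X) k \<lambda>\<close>. The Riccati system makes \<open>R\<close> a gauge transformation between
  the two Lax pairs: \<open>A R + R_x = R A'\<close> and \<open>B R + R_t = R B'\<close>, where \<open>A'\<close>, \<open>B'\<close> belong to \<open>Q\<close>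
  (\<open>gauge_identities\<close>). Hence \<open>r_mat \<xi> k \<lambda> E R / (\<lambda> - k\<^sup>2)\<close> is a frame for \<open>Q\<close> whenever \<open>\<lambda> \<noteq> k\<^sup>2\<close>. At
  \<open>\<lambda> = k\<^sup>2\<close> the matrices \<open>r_mat \<xi> k\<close> and \<open>R\<close> have rank one, with row space spanned by \<open>(1, \<xi>)\<close> and column
  space spanned by \<open>(- X, 1)\<^sup>T\<close>. The product of \<open>(v, w)\<close> with this column is \<open>w - v X = 0\<close>, so the numerator
  vanishes and the quotient extends to an entire function of \<open>\<lambda>\<close>.

  That the extended value at \<open>k\<^sup>2\<close> again solves the Lax system and is smooth in \<open>(x, t)\<close> needs an argument, since
  a frame is smooth in \<open>(x, t)\<close> for fixed \<open>\<lambda>\<close> and holomorphic in \<open>\<lambda>\<close> for fixed \<open>(x, t)\<close>, with no joint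
  regularity given. The value is the pointwise limit of the frames at \<open>\<lambda>\<close>-values tending to \<open>k\<^sup>2\<close>. A
  solution of a linear system at most doubles in norm over a short interval, uniformly along that sequence, so
  dominated convergence carries the system to the limit (\<open>linear_system_limit\<close>). The same growth estimate
  turns separate differentiability into joint continuity, after which the system itself yields derivatives of
  every order (\<open>linear_system_smooth\<close>).
\<close>

section \<open>Calculus of smooth functions\<close>

lemma Ck_on_cong:
  assumes "open S" "\<And>p. p \<in> S \<Longrightarrow> f p = g p"
  shows "Ck_on n S f \<longleftrightarrow> Ck_on n S g"
  using assms(2)
proof (induction n arbitrary: f g)
  case 0
  then show ?case by (auto intro: continuous_on_cong)
next
  case (Suc n)
  have der: "(f has_derivative D) (at p) \<longleftrightarrow> (g has_derivative D) (at p)" if "p \<in> S" for p D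
    using has_derivative_transform_within_open[of f D p UNIV S g]
      has_derivative_transform_within_open[of g D p UNIV S f] assms(1) that Suc.prems
    by auto
  have "frechet_derivative f (at p) = frechet_derivative g (at p)" if "p \<in> S" for p
    unfolding frechet_derivative_def using der[OF that] by simp
  then have "Ck_on n S (\<lambda>p. frechet_derivative f (at p) v)
      \<longleftrightarrow> Ck_on n S (\<lambda>p. frechet_derivative g (at p) v)" for v
    by (intro Suc.IH) simp
  then show ?case
    using der by (auto simp: differentiable_def)
qed

text \<open>It is enough to exhibit the derivative: the condition on \<open>frechet_derivative\<close> transfers by uniqueness of
  derivatives on an open set.\<close>

lemma Ck_on_SucI:
  assumes "open S" "\<And>p. p \<in> S \<Longrightarrow> (f has_derivative D p) (at p)" "\<And>v. Ck_on n S (\<lambda>p. D p v)"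
  shows "Ck_on (Suc n) S f"
proof -
  have "Ck_on n S (\<lambda>p. frechet_derivative f (at p) v)" for v
    using assms(3)[of v] Ck_on_cong[OF assms(1), of "\<lambda>p. frechet_derivative f (at p) v" "\<lambda>p. D p v" n]
      frechet_derivative_at[OF assms(2)] by simp
  then show ?thesis
    using assms(2) by (auto simp: differentiable_def)
qed

lemma Ck_on_SucD: "Ck_on (Suc n) S f \<Longrightarrow> Ck_on n S f"
proof (induction n arbitrary: f)
  case 0
  then show ?case
    by (auto intro!: differentiable_imp_continuous_on differentiable_at_imp_differentiable_on)
next
  case (Suc n)
  then show ?case by (metis Ck_on.simps(2))
qed

lemma Ck_on_has_derivative:
  "Ck_on (Suc n) S f \<Longrightarrow> p \<in> S \<Longrightarrow> (f has_derivative frechet_derivative f (at p)) (at p)"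
  by (simp add: frechet_derivative_works)

lemma Ck_on_const: "open S \<Longrightarrow> Ck_on n S (\<lambda>p. c)"
proof (induction n arbitrary: c)
  case (Suc n)
  then show ?case
    by (intro Ck_on_SucI[where D="\<lambda>p v. 0"]) auto
qed simp

lemma Ck_on_add:
  "open S \<Longrightarrow> Ck_on n S f \<Longrightarrow> Ck_on n S g \<Longrightarrow> Ck_on n S (\<lambda>p. f p + g p)"
proof (induction n arbitrary: f g)
  case 0
  then show ?case by (auto intro: continuous_on_add)
next
  case (Suc n)
  show ?case
    by (rule Ck_on_SucI[OF Suc.prems(1) has_derivative_add
            [OF Ck_on_has_derivative[OF Suc.prems(2)] Ck_on_has_derivative[OF Suc.prems(3)]]])
      (use Suc in auto)
qed

lemma Ck_on_linear:
  assumes "bounded_linear h" "open S"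
  shows "Ck_on n S f \<Longrightarrow> Ck_on n S (\<lambda>p. h (f p))"
proof (induction n arbitrary: f)
  case 0
  then show ?case by (auto intro: bounded_linear.continuous_on assms)
next
  case (Suc n)
  show ?case
    by (rule Ck_on_SucI[OF assms(2) bounded_linear.has_derivative
            [OF assms(1) Ck_on_has_derivative[OF Suc.prems]]])
      (use Suc in auto)
qed

lemma Ck_on_bilinear:
  assumes "bounded_bilinear h" "open S"
  shows "Ck_on n S f \<Longrightarrow> Ck_on n S g \<Longrightarrow> Ck_on n S (\<lambda>p. h (f p) (g p))"
proof (induction n arbitrary: f g)
  case 0
  then show ?case by (auto intro: bounded_bilinear.continuous_on[OF assms(1)])
next
  case (Suc n)
  show ?case
    by (rule Ck_on_SucI[OF assms(2) bounded_bilinear.FDERIV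
            [OF assms(1) Ck_on_has_derivative[OF Suc.prems(1)] Ck_on_has_derivative[OF Suc.prems(2)]]])
      (use Suc Ck_on_SucD[OF Suc.prems(1)] Ck_on_SucD[OF Suc.prems(2)] in \<open>auto intro!: Ck_on_add assms\<close>)
qed

lemma Ck_on_inverse:
  fixes f :: "'a::real_normed_vector \<Rightarrow> 'b::real_normed_field"
  assumes "open S" "\<And>p. p \<in> S \<Longrightarrow> f p \<noteq> 0"
  shows "Ck_on n S f \<Longrightarrow> Ck_on n S (\<lambda>p. inverse (f p))"
proof (induction n)
  case 0
  then show ?case using assms by (auto intro: continuous_on_inverse)
next
  case (Suc n)
  have *: "Ck_on n S (\<lambda>p. inverse (f p))"
    using Suc Ck_on_SucD by blast
  have mult: "Ck_on n S (\<lambda>p. f p * g p)" if "Ck_on n S f" "Ck_on n S g" for f g :: "'a \<Rightarrow> 'b"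
    using Ck_on_bilinear[OF bounded_bilinear_mult assms(1) that] .
  show ?case
    by (rule Ck_on_SucI[OF assms(1) Deriv.has_derivative_inverse
            [OF assms(2) Ck_on_has_derivative[OF Suc.prems]]])
      (use Suc.prems in \<open>auto intro!: mult * Ck_on_linear[OF bounded_linear_minus[OF bounded_linear_ident] assms(1)]\<close>)
qed

lemma smooth_on_cong:
  "open S \<Longrightarrow> (\<And>p. p \<in> S \<Longrightarrow> f p = g p) \<Longrightarrow> smooth_on S g \<Longrightarrow> smooth_on S f"
  using Ck_on_cong[of S f g] by (simp add: smooth_on_def)

lemma smooth_on_subset:
  assumes "T \<subseteq> S"
  shows "smooth_on S f \<Longrightarrow> smooth_on T f"
proof -
  have "Ck_on n S f \<Longrightarrow> Ck_on n T f" for n and f :: "'a \<Rightarrow> 'b"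
    by (induction n arbitrary: f) (use assms in \<open>auto intro: continuous_on_subset\<close>)
  then show "smooth_on S f \<Longrightarrow> smooth_on T f"
    by (simp add: smooth_on_def)
qed

named_theorems smooth_intros

lemma smooth_on_const [smooth_intros]: "open S \<Longrightarrow> smooth_on S (\<lambda>p. c)"
  by (simp add: smooth_on_def Ck_on_const)

lemma smooth_on_add [smooth_intros]:
  "open S \<Longrightarrow> smooth_on S f \<Longrightarrow> smooth_on S g \<Longrightarrow> smooth_on S (\<lambda>p. f p + g p)"
  by (simp add: smooth_on_def Ck_on_add)

lemma smooth_on_linear:
  "bounded_linear h \<Longrightarrow> open S \<Longrightarrow> smooth_on S f \<Longrightarrow> smooth_on S (\<lambda>p. h (f p))"
  by (simp add: smooth_on_def Ck_on_linear)

lemma smooth_on_bilinear: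
  "bounded_bilinear h \<Longrightarrow> open S \<Longrightarrow> smooth_on S f \<Longrightarrow> smooth_on S g \<Longrightarrow>
    smooth_on S (\<lambda>p. h (f p) (g p))"
  by (simp add: smooth_on_def Ck_on_bilinear)

lemmas smooth_on_minus [smooth_intros] =
  smooth_on_linear[OF bounded_linear_minus[OF bounded_linear_ident]]
lemmas smooth_on_nth [smooth_intros] = smooth_on_linear[OF bounded_linear_vec_nth]
lemmas smooth_on_Re [smooth_intros] = smooth_on_linear[OF bounded_linear_Re]
lemmas smooth_on_of_real [smooth_intros] = smooth_on_linear[OF bounded_linear_of_real]
lemmas smooth_on_mult [smooth_intros] = smooth_on_bilinear[OF bounded_bilinear_mult]
lemmas smooth_on_scaleR [smooth_intros] = smooth_on_bilinear[OF bounded_bilinear_scaleR]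

lemma smooth_on_diff [smooth_intros]:
  "open S \<Longrightarrow> smooth_on S f \<Longrightarrow> smooth_on S g \<Longrightarrow> smooth_on S (\<lambda>p. f p - g p)"
  using smooth_on_add[of S f "\<lambda>p. - g p"] smooth_on_minus[of S g] by simp

lemma smooth_on_power [smooth_intros]:
  fixes f :: "'a::real_normed_vector \<Rightarrow> 'b::real_normed_field"
  shows "open S \<Longrightarrow> smooth_on S f \<Longrightarrow> smooth_on S (\<lambda>p. f p ^ n)"
  by (induction n) (simp_all add: smooth_on_const smooth_on_mult)

lemma smooth_on_divide [smooth_intros]:
  fixes f g :: "'a::real_normed_vector \<Rightarrow> 'b::real_normed_field"
  assumes "open S" "smooth_on S f" "smooth_on S g" "\<And>p. p \<in> S \<Longrightarrow> g p \<noteq> 0"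
  shows "smooth_on S (\<lambda>p. f p / g p)"
proof -
  have "smooth_on S (\<lambda>p. inverse (g p))"
    using assms by (simp add: smooth_on_def Ck_on_inverse)
  then show ?thesis
    unfolding divide_inverse by (intro smooth_on_mult assms)
qed

lemma smooth_on_sum [smooth_intros]:
  "open S \<Longrightarrow> (\<And>i. i \<in> I \<Longrightarrow> smooth_on S (f i)) \<Longrightarrow> smooth_on S (\<lambda>p. \<Sum>i\<in>I. f i p)"
  by (induction I rule: infinite_finite_induct) (simp_all add: smooth_on_const smooth_on_add)

lemma bounded_linear_axis: "bounded_linear (axis i :: 'b::real_normed_vector \<Rightarrow> 'b ^ 'n)"
proof (intro bounded_linear_intro)
  show "norm (axis i x :: 'b ^ 'n) \<le> norm x * 1" for x :: 'b
    using L2_set_le_sum[of UNIV "\<lambda>j. norm ((axis i x :: 'b ^ 'n) $ j)"]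
    by (simp add: norm_vec_def axis_def if_distrib cong: if_cong)
qed (auto simp: axis_def vec_eq_iff)

lemma smooth_on_vecI:
  fixes f :: "'a::real_normed_vector \<Rightarrow> 'b::real_normed_vector ^ 'n"
  assumes "open S" "\<And>i. smooth_on S (\<lambda>p. f p $ i)"
  shows "smooth_on S f"
proof -
  have "f p = (\<Sum>i\<in>UNIV. axis i (f p $ i))" for p
    by (simp add: vec_eq_iff axis_def)
  then have "f = (\<lambda>p. \<Sum>i\<in>UNIV. axis i (f p $ i))"
    by auto
  moreover have "smooth_on S (\<lambda>p. \<Sum>i\<in>UNIV. axis i (f p $ i))"
    by (intro smooth_on_sum smooth_on_linear[OF bounded_linear_axis] assms)
  ultimately show ?thesis by simp
qed

lemma ddx_eq:
  assumes "(f has_derivative D) (at p)"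
  shows "ddx f p = D (1, 0)" and "((\<lambda>s. f (s, snd p)) has_vector_derivative D (1, 0)) (at (fst p))"
proof -
  have lin: "(\<lambda>h. D (h, 0)) = (\<lambda>h. h *\<^sub>R D (1, 0))"
    using linear_scale[OF has_derivative_linear[OF assms], of _ "(1, 0)", symmetric] by simp
  have "(f \<circ> (\<lambda>s. (s, snd p)) has_derivative D \<circ> (\<lambda>h. (h, 0))) (at (fst p))"
    using assms by (intro diff_chain_at) (auto intro!: derivative_eq_intros)
  then show *: "((\<lambda>s. f (s, snd p)) has_vector_derivative D (1, 0)) (at (fst p))"
    using lin by (simp add: has_vector_derivative_def o_def)
  show "ddx f p = D (1, 0)"
    unfolding ddx_def using vector_derivative_at[OF *] .
qed

lemma ddt_eq:
  assumes "(f has_derivative D) (at p)"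
  shows "ddt f p = D (0, 1)" and "((\<lambda>s. f (fst p, s)) has_vector_derivative D (0, 1)) (at (snd p))"
proof -
  have lin: "(\<lambda>h. D (0, h)) = (\<lambda>h. h *\<^sub>R D (0, 1))"
    using linear_scale[OF has_derivative_linear[OF assms], of _ "(0, 1)", symmetric] by simp
  have "(f \<circ> (\<lambda>s. (fst p, s)) has_derivative D \<circ> (\<lambda>h. (0, h))) (at (snd p))"
    using assms by (intro diff_chain_at) (auto intro!: derivative_eq_intros)
  then show *: "((\<lambda>s. f (fst p, s)) has_vector_derivative D (0, 1)) (at (snd p))"
    using lin by (simp add: has_vector_derivative_def o_def)
  show "ddt f p = D (0, 1)"
    unfolding ddt_def using vector_derivative_at[OF *] .
qed

lemma smooth_on_differentiable:
  assumes "smooth_on S f" "p \<in> S"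
  shows "(f has_derivative frechet_derivative f (at p)) (at p)"
  using assms Ck_on_has_derivative[of 0 S f p] unfolding smooth_on_def by blast

text \<open>Linearity expresses the total derivative through the partial derivatives, which are one-dimensional
  derivatives along the coordinate lines. The equations for curve, potential and frame are stated in terms of these.\<close>

lemma smooth_on_has_derivative:
  assumes "smooth_on S f" "p \<in> S"
  shows "(f has_derivative (\<lambda>h. fst h *\<^sub>R ddx f p + snd h *\<^sub>R ddt f p)) (at p)"
proof -
  note D = smooth_on_differentiable[OF assms]
  have "frechet_derivative f (at p) h = fst h *\<^sub>R ddx f p + snd h *\<^sub>R ddt f p" for h
  proof -
    have "h = fst h *\<^sub>R (1, 0) + snd h *\<^sub>R (0, 1)"
      by (cases h) simp
    then have "frechet_derivative f (at p) h =
        frechet_derivative f (at p) (fst h *\<^sub>R (1, 0) + snd h *\<^sub>R (0, 1))"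
      by simp
    also have "\<dots> = fst h *\<^sub>R frechet_derivative f (at p) (1, 0) + snd h *\<^sub>R frechet_derivative f (at p) (0, 1)"
      using has_derivative_linear[OF D] by (simp only: linear_add linear_scale)
    finally show ?thesis
      using ddx_eq(1)[OF D] ddt_eq(1)[OF D] by simp
  qed
  then show ?thesis using D by presburger
qed

lemma smooth_on_ddx [smooth_intros]:
  assumes "open S" "smooth_on S f"
  shows "smooth_on S (ddx f)"
proof (rule smooth_on_cong[OF assms(1)])
  show "smooth_on S (\<lambda>p. frechet_derivative f (at p) (1, 0))"
    using assms(2) unfolding smooth_on_def by (metis Ck_on.simps(2))
qed (rule ddx_eq(1)[OF smooth_on_differentiable[OF assms(2)]])

lemma smooth_on_ddt [smooth_intros]:
  assumes "open S" "smooth_on S f"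
  shows "smooth_on S (ddt f)"
proof (rule smooth_on_cong[OF assms(1)])
  show "smooth_on S (\<lambda>p. frechet_derivative f (at p) (0, 1))"
    using assms(2) unfolding smooth_on_def by (metis Ck_on.simps(2))
qed (rule ddt_eq(1)[OF smooth_on_differentiable[OF assms(2)]])

lemma smooth_on_imp_continuous_on: "smooth_on S f \<Longrightarrow> continuous_on S f"
  unfolding smooth_on_def by (metis Ck_on.simps(1))

lemma ddx_cong:
  assumes "open S" "p \<in> S" "\<And>p. p \<in> S \<Longrightarrow> f p = g p"
  shows "ddx f p = ddx g p"
proof -
  have "\<forall>\<^sub>F s in nhds (fst p). (s, snd p) \<in> S"
    using assms(1,2) by (intro eventually_nhds[THEN iffD2] exI[of _ "(\<lambda>s. (s, snd p)) -` S"])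
      (auto intro!: open_vimage continuous_intros)
  then show ?thesis
    unfolding ddx_def by (intro vector_derivative_cong_eq) (use assms in \<open>auto elim!: eventually_mono\<close>)
qed

text \<open>Symmetry of mixed partials by integration: \<open>f(y,t) - f(a,t)\<close> is the integral of \<open>f_x\<close> over \<open>[a,y]\<close>.
  Differentiating under the integral sign in \<open>t\<close>, and then in the upper limit \<open>y\<close>, gives \<open>f_ty = f_yt\<close>.\<close>

lemma ddt_ddx_commute:
  fixes f :: "real \<times> real \<Rightarrow> 'b::banach"
  assumes "smooth_on UNIV f"
  shows "ddt (ddx f) p = ddx (ddt f) p"
proof -
  obtain x t where p: "p = (x, t)" by fastforce
  note sx = smooth_on_ddx[OF open_UNIV assms]
  note sxt = smooth_on_ddt[OF open_UNIV sx]
  have dx: "((\<lambda>s. f (s, t)) has_vector_derivative ddx f (s, t)) (at s)" for s t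
    using ddx_eq(2)[OF smooth_on_has_derivative[OF assms], of "(s,t)"] by simp
  have dt: "((\<lambda>t. f (s, t)) has_vector_derivative ddt f (s, t)) (at t)" for s t
    using ddt_eq(2)[OF smooth_on_has_derivative[OF assms], of "(s,t)"] by simp
  have dxt: "((\<lambda>t. ddx f (s, t)) has_vector_derivative ddt (ddx f) (s, t)) (at t)" for s t
    using ddt_eq(2)[OF smooth_on_has_derivative[OF sx], of "(s,t)"] by simp
  \<comment> \<open>Any base point strictly below \<open>x\<close> works; the interval must contain \<open>x\<close> in its interior.\<close>
  define a where "a = x - 1"
  have ftc: "((\<lambda>s. ddx f (s, t)) has_integral (f (y, t) - f (a, t))) {a..y}" if "a \<le> y" for y t
    using that dx by (intro fundamental_theorem_of_calculus) (auto intro: has_vector_derivative_at_within)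
  have cont: "continuous_on A (\<lambda>s. ddt (ddx f) (s, t))" for A
    by (rule continuous_on_compose2[OF smooth_on_imp_continuous_on[OF sxt]])
      (auto intro!: continuous_intros)
  have eq: "ddt f (y, t) = ddt f (a, t) + integral {a..y} (\<lambda>s. ddt (ddx f) (s, t))" if "a \<le> y" for y
  proof -
    have "((\<lambda>t. integral (cbox a y) (\<lambda>s. ddx f (s, t))) has_vector_derivative
        integral (cbox a y) (\<lambda>s. ddt (ddx f) (s, t))) (at t within UNIV)"
    proof (rule leibniz_rule_vector_derivative[where U=UNIV])
      show "(\<lambda>s. ddx f (s, t)) integrable_on cbox a y" for t
        using ftc[OF that] by auto
      have "continuous_on (UNIV \<times> cbox a y) (\<lambda>z. ddt (ddx f) (snd z, fst z))"
        by (rule continuous_on_compose2[OF smooth_on_imp_continuous_on[OF sxt]])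
          (auto intro!: continuous_intros)
      then show "continuous_on (UNIV \<times> cbox a y) (\<lambda>(t, s). ddt (ddx f) (s, t))"
        by (simp add: case_prod_unfold)
    qed (use dxt in auto)
    then have "((\<lambda>t. f (y, t) - f (a, t)) has_vector_derivative
        integral {a..y} (\<lambda>s. ddt (ddx f) (s, t))) (at t)"
      using ftc[OF that, THEN integral_unique] by simp
    moreover have "((\<lambda>t. f (y, t) - f (a, t)) has_vector_derivative (ddt f (y, t) - ddt f (a, t))) (at t)"
      by (intro derivative_intros dt)
    ultimately have "integral {a..y} (\<lambda>s. ddt (ddx f) (s, t)) = ddt f (y, t) - ddt f (a, t)"
      by (rule vector_derivative_unique_at)
    then show ?thesis by simp
  qed
  have "x \<in> {a..x + 1}"
    by (simp add: a_def)
  have "((\<lambda>y. ddt f (a, t) + integral {a..y} (\<lambda>s. ddt (ddx f) (s, t))) has_vector_derivative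
      0 + ddt (ddx f) (x, t)) (at x within {a..x + 1})"
    by (intro derivative_intros integral_has_vector_derivative cont) (auto simp: a_def)
  then have "((\<lambda>y. ddt f (y, t)) has_vector_derivative ddt (ddx f) (x, t)) (at x within {a..x + 1})"
    unfolding add_0_left by (rule has_vector_derivative_transform[rotated 2]) (use \<open>x \<in> {a..x + 1}\<close> in \<open>auto intro: eq\<close>)
  then have "((\<lambda>y. ddt f (y, t)) has_vector_derivative ddt (ddx f) (x, t)) (at x)"
    by (simp add: at_within_Icc_at a_def)
  then show ?thesis
    unfolding ddx_def[of "ddt f"] p by (simp add: vector_derivative_at)
qed

section \<open>Linear systems of differential equations\<close>

text \<open>A substitute for Gronwall's inequality on an interval of length at most \<open>1 / (2 C)\<close>. If \<open>norm f\<close> is maximal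
  at \<open>m\<close>, the mean value inequality gives \<open>norm (f m - f u) \<le> norm (f m) / 2\<close>, whence
  \<open>norm (f m) \<le> 2 * norm (f u)\<close>.\<close>

lemma linear_growth_on_short_interval:
  fixes f :: "real \<Rightarrow> 'a::real_normed_vector"
  assumes der: "\<And>s. s \<in> {a..b} \<Longrightarrow> (f has_vector_derivative f' s) (at s within {a..b})"
    and bound: "\<And>s. s \<in> {a..b} \<Longrightarrow> norm (f' s) \<le> C * norm (f s)"
    and C: "0 \<le> C" "C * (b - a) \<le> 1/2" and u: "u \<in> {a..b}" and s: "s \<in> {a..b}"
  shows "norm (f s) \<le> 2 * norm (f u)" and "norm (f s - f u) \<le> 2 * C * norm (f u) * \<bar>s - u\<bar>"
proof -
  have "continuous_on {a..b} (\<lambda>s. norm (f s))"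
    using continuous_on_norm[OF continuous_on_vector_derivative[OF der]] by simp
  then obtain m where m: "m \<in> {a..b}" "\<And>s. s \<in> {a..b} \<Longrightarrow> norm (f s) \<le> norm (f m)"
    using continuous_attains_sup[of "{a..b}" "\<lambda>s. norm (f s)"] u by fastforce
  have lip: "norm (f s - f u) \<le> C * norm (f m) * norm (s - u)" if "s \<in> {a..b}" for s
  proof (rule differentiable_bound[of "{a..b}" f "\<lambda>s h. h *\<^sub>R f' s"])
    show "onorm (\<lambda>h. h *\<^sub>R f' x) \<le> C * norm (f m)" if "x \<in> {a..b}" for x
    proof -
      have "C * norm (f x) \<le> C * norm (f m)"
        using m(2)[OF that] C(1) by (rule mult_left_mono)
      then show ?thesis
        using bound[OF that] by (simp add: onorm_scaleR_left[OF bounded_linear_ident] onorm_id)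
    qed
  qed (use der that u in \<open>auto simp: has_vector_derivative_def\<close>)
  have "C * norm (f m) * norm (m - u) \<le> C * norm (f m) * (b - a)"
    using m(1) u C(1) by (intro mult_left_mono) auto
  also have "\<dots> = (C * (b - a)) * norm (f m)"
    by simp
  also have "\<dots> \<le> 1/2 * norm (f m)"
    using C(2) by (intro mult_right_mono) auto
  finally have "norm (f m - f u) \<le> norm (f m) / 2"
    using lip[OF m(1)] by simp
  then have max: "norm (f m) \<le> 2 * norm (f u)"
    using norm_triangle_ineq2[of "f m" "f u"] by linarith
  show "norm (f s) \<le> 2 * norm (f u)"
    using m(2)[OF s] max by simp
  have "C * norm (f m) * norm (s - u) \<le> C * (2 * norm (f u)) * norm (s - u)"
    using max C(1) by (intro mult_right_mono mult_left_mono) auto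
  then show "norm (f s - f u) \<le> 2 * C * norm (f u) * \<bar>s - u\<bar>"
    using lip[OF s] by (simp add: mult_ac)
qed

text \<open>The bound on the derivatives makes the limit \<open>g\<close> Lipschitz, hence continuous, and dominated convergence
  shows that \<open>g\<close> is a primitive of \<open>g'\<close>. The assumption \<open>cont\<close> is tailored to differential equations, where \<open>g'\<close>
  is a continuous expression in \<open>g\<close>.\<close>

lemma has_vector_derivative_pointwise_limit:
  fixes f :: "nat \<Rightarrow> real \<Rightarrow> 'a::euclidean_space"
  assumes der: "\<And>n s. s \<in> {a..b} \<Longrightarrow> (f n has_vector_derivative f' n s) (at s within {a..b})"
    and bound: "\<And>n s. s \<in> {a..b} \<Longrightarrow> norm (f' n s) \<le> K"
    and lim: "\<And>s. s \<in> {a..b} \<Longrightarrow> (\<lambda>n. f n s) \<longlonglongrightarrow> g s"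
    and lim': "\<And>s. s \<in> {a..b} \<Longrightarrow> (\<lambda>n. f' n s) \<longlonglongrightarrow> g' s"
    and cont: "continuous_on {a..b} g \<Longrightarrow> continuous_on {a..b} g'"
    and s: "s \<in> {a..b}"
  shows "(g has_vector_derivative g' s) (at s within {a..b})"
proof -
  have lip: "norm (g x - g y) \<le> K * norm (x - y)" if "x \<in> {a..b}" "y \<in> {a..b}" for x y
  proof (rule LIMSEQ_le_const2)
    show "(\<lambda>n. norm (f n x - f n y)) \<longlonglongrightarrow> norm (g x - g y)"
      by (intro tendsto_intros lim that)
    have "norm (f n x - f n y) \<le> K * norm (x - y)" for n
      by (rule differentiable_bound[of "{a..b}" "f n" "\<lambda>s h. h *\<^sub>R f' n s"])
        (use der bound that in \<open>auto simp: has_vector_derivative_def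
          onorm_scaleR_left[OF bounded_linear_ident] onorm_id\<close>)
    then show "\<exists>N. \<forall>n\<ge>N. norm (f n x - f n y) \<le> K * norm (x - y)"
      by blast
  qed
  have "K \<ge> 0"
    using bound[OF s, of 0] norm_ge_zero order_trans by blast
  then have "K-lipschitz_on {a..b} g"
    using lip by (auto simp: lipschitz_on_def dist_norm)
  then have contg': "continuous_on {a..b} g'"
    using cont lipschitz_on_continuous_on by blast
  have eq: "g x = g a + integral {a..x} g'" if "x \<in> {a..b}" for x
  proof -
    have sub: "{a..x} \<subseteq> {a..b}" using that by auto
    have int: "(f' n has_integral (f n x - f n a)) {a..x}" for n
      using that sub by (intro fundamental_theorem_of_calculus)
        (auto intro: has_vector_derivative_within_subset[OF der])
    have "(\<lambda>n. integral {a..x} (f' n)) \<longlonglongrightarrow> integral {a..x} g'"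
      by (rule dominated_convergence(2)[where h="\<lambda>_. K"])
        (use int sub bound lim' in \<open>auto\<close>)
    then have "(\<lambda>n. f n x - f n a) \<longlonglongrightarrow> integral {a..x} g'"
      using int[THEN integral_unique] by simp
    moreover have "(\<lambda>n. f n x - f n a) \<longlonglongrightarrow> g x - g a"
      using that by (intro tendsto_intros lim) auto
    ultimately have "integral {a..x} g' = g x - g a"
      by (rule LIMSEQ_unique)
    then show ?thesis by simp
  qed
  have "((\<lambda>x. g a + integral {a..x} g') has_vector_derivative 0 + g' s) (at s within {a..b})"
    by (intro derivative_intros integral_has_vector_derivative contg' s)
  then show ?thesis
    unfolding add_0_left by (rule has_vector_derivative_transform[OF s, rotated]) (rule eq)
qed

lemma bounded_bilinear_matrix_mult:
  "bounded_bilinear ((**) :: complex ^ 'n ^ 'n \<Rightarrow> complex ^ 'n ^ 'n \<Rightarrow> complex ^ 'n ^ 'n)"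
proof -
  have "bilinear ((**) :: complex ^ 'n ^ 'n \<Rightarrow> complex ^ 'n ^ 'n \<Rightarrow> complex ^ 'n ^ 'n)"
    unfolding bilinear_def
    by (auto intro!: linearI simp:
        matrix_matrix_mult_def vec_eq_iff scaleR_sum_right sum.distrib algebra_simps)
  then show ?thesis
    by (simp add: bilinear_conv_bounded_bilinear)
qed

lemma matrix_mult_norm_bound:
  "\<exists>K>0. \<forall>(A :: complex ^ 'n ^ 'n) B :: complex ^ 'n ^ 'n. norm (A ** B) \<le> norm A * norm B * K"
  using bounded_bilinear.pos_bounded[OF bounded_bilinear_matrix_mult] .

text \<open>Pointwise limits of solutions are solutions. Near \<open>u\<close> the coefficients \<open>B (\<mu> n)\<close> are bounded uniformly in \<open>n\<close>
  by compactness, so the growth lemma bounds the solutions \<open>F (\<mu> n)\<close> by twice their convergent values at \<open>u\<close>.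
  That is the uniform bound on the derivatives which the preceding limit lemma needs.\<close>

lemma linear_system_limit:
  fixes F :: "complex \<Rightarrow> real \<Rightarrow> complex ^ 'n ^ 'n" and B :: "complex \<Rightarrow> real \<Rightarrow> complex ^ 'n ^ 'n"
  assumes I: "open I" "u \<in> I"
    and B: "continuous_on (UNIV \<times> I) (\<lambda>z. B (fst z) (snd z))"
    and sol: "\<And>n s. s \<in> I \<Longrightarrow> (F (\<mu> n) has_vector_derivative F (\<mu> n) s ** B (\<mu> n) s) (at s)"
    and lim: "\<And>s. s \<in> I \<Longrightarrow> (\<lambda>n. F (\<mu> n) s) \<longlonglongrightarrow> F \<mu>0 s"
    and \<mu>: "\<mu> \<longlonglongrightarrow> \<mu>0"
  shows "(F \<mu>0 has_vector_derivative F \<mu>0 u ** B \<mu>0 u) (at u)"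
proof -
  obtain d where d: "d > 0" "{u - d..u + d} \<subseteq> I"
    using I unfolding open_contains_cball cball_eq_atLeastAtMost by blast
  obtain K where "0 < K \<and> (\<forall>(A :: complex ^ 'n ^ 'n) B :: complex ^ 'n ^ 'n. norm (A ** B) \<le> norm A * norm B * K)"
    using matrix_mult_norm_bound by (rule exE)
  then have K: "0 < K" "norm (A ** B) \<le> norm A * norm B * K" for A B :: "complex ^ 'n ^ 'n"
    by simp_all
  obtain R where R: "\<And>n. norm (\<mu> n) \<le> R"
    using convergent_imp_Bseq[of \<mu>] \<mu> by (auto simp: convergent_def Bseq_def)
  have "compact ((\<lambda>z. B (fst z) (snd z)) ` (cball 0 R \<times> {u - d..u + d}))"
    by (intro compact_continuous_image compact_Times continuous_on_subset[OF B])
      (use d in auto)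
  then obtain C where C: "\<And>l s. norm l \<le> R \<Longrightarrow> s \<in> {u - d..u + d} \<Longrightarrow> norm (B l s) \<le> C"
    by (force dest!: compact_imp_bounded simp: bounded_iff)
  have "0 \<le> C"
    using order_trans[OF norm_ge_zero C[OF R, of u 0]] d(1) by simp
  \<comment> \<open>The factor 4 leaves room for an interval of length \<open>2 e\<close>; adding 1 covers the case \<open>C = 0\<close>.\<close>
  define e where "e = min d (1 / (4 * (C * K + 1)))"
  have e: "0 < e" "e \<le> d"
    using d \<open>0 \<le> C\<close> K(1) by (auto simp: e_def intro!: divide_pos_pos add_nonneg_pos)
  have "C * K * (2 * e) \<le> C * K * (2 * (1 / (4 * (C * K + 1))))"
    using \<open>0 \<le> C\<close> K(1) by (intro mult_left_mono) (auto simp: e_def)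
  also have "\<dots> \<le> 1/2"
  proof -
    have "0 \<le> C * K"
      using \<open>0 \<le> C\<close> K(1) by simp
    then show ?thesis by (simp add: divide_simps)
  qed
  finally have small: "C * K * ((u + e) - (u - e)) \<le> 1/2"
    by simp
  let ?J = "{u - e..u + e}"
  have J: "?J \<subseteq> I" "?J \<subseteq> {u - d..u + d}" "u \<in> ?J"
    using d e by auto
  have der: "(F (\<mu> n) has_vector_derivative F (\<mu> n) s ** B (\<mu> n) s) (at s within ?J)" if "s \<in> ?J" for n s
    using sol that J(1) by (blast intro: has_vector_derivative_at_within)
  have rate: "norm (F (\<mu> n) s ** B (\<mu> n) s) \<le> C * K * norm (F (\<mu> n) s)" if "s \<in> ?J" for n s
  proof -
    have "norm (F (\<mu> n) s) * norm (B (\<mu> n) s) * K \<le> norm (F (\<mu> n) s) * C * K"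
      using C[OF R, of s n] that J(2) K(1) by (intro mult_right_mono mult_left_mono) auto
    then show ?thesis using K(2)[of "F (\<mu> n) s" "B (\<mu> n) s"] by (simp add: mult_ac)
  qed
  obtain M where M: "\<And>n. norm (F (\<mu> n) u) \<le> M"
    using convergent_imp_Bseq[of "\<lambda>n. F (\<mu> n) u"] lim[OF I(2)] by (auto simp: convergent_def Bseq_def)
  have "(F \<mu>0 has_vector_derivative F \<mu>0 u ** B \<mu>0 u) (at u within ?J)"
  proof (rule has_vector_derivative_pointwise_limit[where f="\<lambda>n. F (\<mu> n)" and K="C * K * (2 * M)" and g'="\<lambda>s. F \<mu>0 s ** B \<mu>0 s"])
    show "norm (F (\<mu> n) s ** B (\<mu> n) s) \<le> C * K * (2 * M)" if "s \<in> ?J" for n s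
    proof -
      have "norm (F (\<mu> n) s) \<le> 2 * norm (F (\<mu> n) u)"
        using linear_growth_on_short_interval(1)[of "u - e" "u + e" "F (\<mu> n)" "\<lambda>s. F (\<mu> n) s ** B (\<mu> n) s"
            "C * K" u s] der rate small J(3) that \<open>0 \<le> C\<close> K(1) by auto
      then have "norm (F (\<mu> n) s) \<le> 2 * M"
        using M[of n] by linarith
      then have "C * K * norm (F (\<mu> n) s) \<le> C * K * (2 * M)"
        using \<open>0 \<le> C\<close> K(1) by (intro mult_left_mono) auto
      then show ?thesis using rate[OF that, of n] by linarith
    qed
    show "(\<lambda>n. F (\<mu> n) s ** B (\<mu> n) s) \<longlonglongrightarrow> F \<mu>0 s ** B \<mu>0 s" if "s \<in> ?J" for s
    proof (rule bounded_bilinear.tendsto[OF bounded_bilinear_matrix_mult lim])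
      have "continuous_on UNIV (\<lambda>l. B l s)"
        by (rule continuous_on_compose2[OF B, of UNIV "\<lambda>l. (l, s)", simplified])
          (use that J in \<open>auto intro: continuous_on_Pair continuous_on_id continuous_on_const\<close>)
      then show "(\<lambda>n. B (\<mu> n) s) \<longlonglongrightarrow> B \<mu>0 s"
        by (rule continuous_on_tendsto_compose[OF _ \<mu>]) auto
    qed (use that J in auto)
    have "continuous_on ?J (B \<mu>0)"
      by (rule continuous_on_compose2[OF B, of ?J "\<lambda>s. (\<mu>0, s)", simplified])
        (use J in \<open>auto intro: continuous_on_Pair continuous_on_id continuous_on_const\<close>)
    then show "continuous_on ?J (F \<mu>0) \<Longrightarrow> continuous_on ?J (\<lambda>s. F \<mu>0 s ** B \<mu>0 s)"
      by (intro bounded_bilinear.continuous_on[OF bounded_bilinear_matrix_mult])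
  qed (use der lim J in auto)
  then show ?thesis
    using e by (simp add: at_within_Icc_at)
qed

lemma has_derivative_from_partials:
  fixes f :: "real \<times> real \<Rightarrow> 'a::real_normed_vector"
  assumes S: "open S" "p \<in> S"
    and fx: "\<And>x t. (x, t) \<in> S \<Longrightarrow> ((\<lambda>s. f (s, t)) has_vector_derivative fx (x, t)) (at x)"
    and ft: "\<And>x t. (x, t) \<in> S \<Longrightarrow> ((\<lambda>s. f (x, s)) has_vector_derivative ft (x, t)) (at t)"
    and cont: "continuous_on S ft"
  shows "(f has_derivative (\<lambda>h. fst h *\<^sub>R fx p + snd h *\<^sub>R ft p)) (at p)"
proof -
  obtain x t where p: "p = (x, t)" by fastforce
  obtain X T where XT: "open X" "open T" "p \<in> X \<times> T" "X \<times> T \<subseteq> S"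
    using open_prod_elim[OF S] by metis
  obtain e where e: "e > 0" "ball t e \<subseteq> T"
    using XT p openE by blast
  let ?Y = "ball t e"
  have sub: "X \<times> ?Y \<subseteq> S" using XT(4) e(2) by blast
  have "((\<lambda>(x, y). f (x, y)) has_derivative (\<lambda>(h, k). h *\<^sub>R fx (x, t)
      + blinfun_apply (blinfun_scaleR_left (ft (x, t))) k)) (at (x, t) within X \<times> ?Y)"
  proof (rule has_derivative_partialsI[where fy="\<lambda>x y. blinfun_scaleR_left (ft (x, y))"])
    show "((\<lambda>x. f (x, t)) has_derivative (\<lambda>h. h *\<^sub>R fx (x, t))) (at x within X)"
      using fx[of x t] S(2) p by (auto simp: has_vector_derivative_def intro: has_derivative_at_withinI)
    show "((\<lambda>y. f (x, y)) has_derivative blinfun_apply (blinfun_scaleR_left (ft (x, y)))) (at y within ?Y)"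
      if "x \<in> X" "y \<in> ?Y" for x y
    proof -
      have "(x, y) \<in> S" using that sub by blast
      then show ?thesis
        using ft[of x y] by (auto simp: has_vector_derivative_def intro: has_derivative_at_withinI)
    qed
    have "continuous (at (x, t)) (\<lambda>z. blinfun_scaleR_left (ft z))"
      using cont S p by (intro continuous_intros)
        (simp add: continuous_on_eq_continuous_at)
    then show "continuous (at (x, t) within X \<times> ?Y) (\<lambda>(x, y). blinfun_scaleR_left (ft (x, y)))"
      by (simp add: case_prod_unfold continuous_at_imp_continuous_at_within)
  qed (use e in auto)
  moreover have "at (x, t) within X \<times> ?Y = at (x, t)"
    using XT p e by (intro at_within_open open_Times) auto
  ultimately show ?thesis
    unfolding p by (simp add: case_prod_unfold)
qed

text \<open>The two equations are only assumed along coordinate lines. The growth lemma, applied from \<open>(x,t)\<close> to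
  \<open>(x,t')\<close> and then to \<open>(x',t')\<close>, gives joint continuity. If \<open>F\<close> is \<open>C\<^sup>n\<close> then so are its partial derivatives
  \<open>F A\<close> and \<open>F B\<close>, hence \<open>F\<close> is \<open>C\<close> of order \<open>n + 1\<close>.\<close>

lemma linear_system_smooth:
  fixes F :: "real \<times> real \<Rightarrow> complex ^ 'n ^ 'n"
  assumes S: "open S" and A: "smooth_on S A" and B: "smooth_on S B"
    and Fx: "\<And>x t. (x, t) \<in> S \<Longrightarrow> ((\<lambda>s. F (s, t)) has_vector_derivative F (x, t) ** A (x, t)) (at x)"
    and Ft: "\<And>x t. (x, t) \<in> S \<Longrightarrow> ((\<lambda>s. F (x, s)) has_vector_derivative F (x, t) ** B (x, t)) (at t)"
  shows "smooth_on S F"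
proof -
  obtain K where "0 < K \<and> (\<forall>(A :: complex ^ 'n ^ 'n) B :: complex ^ 'n ^ 'n. norm (A ** B) \<le> norm A * norm B * K)"
    using matrix_mult_norm_bound by (rule exE)
  then have K: "0 < K" "norm (A ** B) \<le> norm A * norm B * K" for A B :: "complex ^ 'n ^ 'n"
    by simp_all
  have "isCont F p" if "p \<in> S" for p
  proof -
    obtain x t where p: "p = (x, t)" by fastforce
    obtain X T where XT: "open X" "open T" "p \<in> X \<times> T" "X \<times> T \<subseteq> S"
      using open_prod_elim[OF S \<open>p \<in> S\<close>] by metis
    obtain d1 d2 where d12: "d1 > 0" "cball x d1 \<subseteq> X" "d2 > 0" "cball t d2 \<subseteq> T"
      using XT p unfolding open_contains_cball by blast
    define d where "d = min d1 d2"
    have d: "d > 0" "{x - d..x + d} \<times> {t - d..t + d} \<subseteq> S"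
    proof -
      have "cball x d \<subseteq> X" "cball t d \<subseteq> T"
        using d12 subset_cball[of d d1 x] subset_cball[of d d2 t] by (simp_all add: d_def)
      then show "{x - d..x + d} \<times> {t - d..t + d} \<subseteq> S"
        using XT(4) unfolding cball_eq_atLeastAtMost by blast
    qed (use d12 in \<open>simp add: d_def\<close>)
    let ?Q = "{x - d..x + d} \<times> {t - d..t + d}"
    have bdd: "bounded (G ` ?Q)" if "smooth_on S G" for G :: "real \<times> real \<Rightarrow> complex ^ 'n ^ 'n"
      by (intro compact_imp_bounded compact_continuous_image compact_Times
          continuous_on_subset[OF smooth_on_imp_continuous_on[OF that]] d) auto
    obtain C where C: "C > 0" "\<And>z. z \<in> ?Q \<Longrightarrow> norm (A z) \<le> C" "\<And>z. z \<in> ?Q \<Longrightarrow> norm (B z) \<le> C"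
    proof -
      obtain a where "a > 0" "\<And>z. z \<in> ?Q \<Longrightarrow> norm (A z) \<le> a"
        using bdd[OF A] unfolding bounded_pos by blast
      moreover obtain b where "b > 0" "\<And>z. z \<in> ?Q \<Longrightarrow> norm (B z) \<le> b"
        using bdd[OF B] unfolding bounded_pos by blast
      ultimately show ?thesis
        using that[of "max a b"] by (simp add: max.coboundedI1 max.coboundedI2)
    qed
    define L where "L = C * K"
    have L: "L > 0" using C K by (simp add: L_def)
    have rate: "norm (F z ** M) \<le> L * norm (F z)" if "norm M \<le> C" for M :: "complex ^ 'n ^ 'n" and z
    proof -
      have "norm (F z) * norm M * K \<le> norm (F z) * C * K"
        using that K(1) by (intro mult_right_mono mult_left_mono) auto
      then show ?thesis using K(2)[of "F z" M] by (simp add: mult_ac L_def)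
    qed
    define e where "e = min d (1 / (4 * L))"
    have e: "0 < e" "e \<le> d"
      using d L by (auto simp: e_def)
    have "L * (2 * e) \<le> L * (2 * (1 / (4 * L)))"
      using L by (intro mult_left_mono) (auto simp: e_def)
    then have small: "L * ((c + e) - (c - e)) \<le> 1/2" for c
      using L by simp
    have t_step: "norm (F (x, t') - F p) \<le> 2 * L * norm (F p) * \<bar>t' - t\<bar>"
      and t_bound: "norm (F (x, t')) \<le> 2 * norm (F p)" if "t' \<in> {t - e..t + e}" for t'
    proof -
      have D: "((\<lambda>s. F (x, s)) has_vector_derivative F (x, s) ** B (x, s)) (at s within {t - e..t + e})"
        "norm (F (x, s) ** B (x, s)) \<le> L * norm (F (x, s))" if "s \<in> {t - e..t + e}" for s
      proof -
        have "(x, s) \<in> ?Q" using that e d(1) by auto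
        then show "((\<lambda>s. F (x, s)) has_vector_derivative F (x, s) ** B (x, s)) (at s within {t - e..t + e})"
          "norm (F (x, s) ** B (x, s)) \<le> L * norm (F (x, s))"
          using Ft d(2) C(3) rate by (blast intro: has_vector_derivative_at_within)+
      qed
      show "norm (F (x, t') - F p) \<le> 2 * L * norm (F p) * \<bar>t' - t\<bar>" "norm (F (x, t')) \<le> 2 * norm (F p)"
        using linear_growth_on_short_interval[OF D less_imp_le[OF L] small _ that, of t] e p by auto
    qed
    have x_step: "norm (F (x', t') - F (x, t')) \<le> 2 * L * norm (F (x, t')) * \<bar>x' - x\<bar>"
      if "x' \<in> {x - e..x + e}" "t' \<in> {t - e..t + e}" for x' t'
    proof -
      have D: "((\<lambda>s. F (s, t')) has_vector_derivative F (s, t') ** A (s, t')) (at s within {x - e..x + e})"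
        "norm (F (s, t') ** A (s, t')) \<le> L * norm (F (s, t'))" if "s \<in> {x - e..x + e}" for s
      proof -
        have "(s, t') \<in> ?Q" using that \<open>t' \<in> _\<close> e d(1) by auto
        then show "((\<lambda>s. F (s, t')) has_vector_derivative F (s, t') ** A (s, t')) (at s within {x - e..x + e})"
          "norm (F (s, t') ** A (s, t')) \<le> L * norm (F (s, t'))"
          using Fx d(2) C(2) rate by (blast intro: has_vector_derivative_at_within)+
      qed
      show ?thesis
        using linear_growth_on_short_interval(2)[OF D less_imp_le[OF L] small _ that(1), of x] e by auto
    qed
    define M where "M = norm (F p)"
    have est: "norm (F z - F p) \<le> 4 * L * M * \<bar>fst z - x\<bar> + 2 * L * M * \<bar>snd z - t\<bar>"
      if z: "z \<in> {x - e<..<x + e} \<times> {t - e<..<t + e}" for z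
    proof -
      obtain x' t' where z': "z = (x', t')" by fastforce
      have in': "x' \<in> {x - e..x + e}" "t' \<in> {t - e..t + e}"
        using z z' by auto
      have "2 * L * norm (F (x, t')) * \<bar>x' - x\<bar> \<le> 2 * L * (2 * M) * \<bar>x' - x\<bar>"
        using t_bound[OF in'(2)] L by (intro mult_right_mono mult_left_mono) (auto simp: M_def)
      moreover have "norm (F z - F p) \<le> norm (F (x', t') - F (x, t')) + norm (F (x, t') - F p)"
        using norm_triangle_ineq[of "F (x', t') - F (x, t')" "F (x, t') - F p"] by (simp add: z')
      ultimately show ?thesis
        using x_step[OF in'] t_step[OF in'(2)]
        unfolding z' M_def fst_conv snd_conv by (simp add: algebra_simps)
    qed
    have "\<forall>\<^sub>F z in at p. z \<in> {x - e<..<x + e} \<times> {t - e<..<t + e}"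
      using p e by (intro eventually_at_topological[THEN iffD2] exI[of _ "{x - e<..<x + e} \<times> {t - e<..<t + e}"])
        (auto intro!: open_Times)
    then have ev: "\<forall>\<^sub>F z in at p. norm (F z - F p) \<le> 4 * L * M * \<bar>fst z - x\<bar> + 2 * L * M * \<bar>snd z - t\<bar>"
      by (rule eventually_mono) (rule est)
    have lim: "((\<lambda>z. 4 * L * M * \<bar>fst z - x\<bar> + 2 * L * M * \<bar>snd z - t\<bar>) \<longlongrightarrow>
        4 * L * M * \<bar>fst p - x\<bar> + 2 * L * M * \<bar>snd p - t\<bar>) (at p)"
      by (intro tendsto_intros)
    have "((\<lambda>z. 4 * L * M * \<bar>fst z - x\<bar> + 2 * L * M * \<bar>snd z - t\<bar>) \<longlongrightarrow> 0) (at p)"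
      using lim by (simp add: p)
    with ev have "((\<lambda>z. F z - F p) \<longlongrightarrow> 0) (at p)"
      by (rule Lim_null_comparison)
    then show "isCont F p"
      by (simp add: isCont_def LIM_zero_iff)
  qed
  then have "Ck_on 0 S F"
    by (simp add: continuous_at_imp_continuous_on)
  have Ck: "Ck_on n S A" "Ck_on n S B" for n
    using A B by (auto simp: smooth_on_def)
  have mult: "Ck_on n S (\<lambda>p. F p ** A p)" "Ck_on n S (\<lambda>p. F p ** B p)" if "Ck_on n S F" for n
    using Ck_on_bilinear[OF bounded_bilinear_matrix_mult S that] Ck by auto
  have "Ck_on n S F" for n
  proof (induction n)
    case 0
    show ?case by fact
  next
    case (Suc n)
    have "continuous_on S (\<lambda>p. F p ** B p)"
      using mult(2)[OF \<open>Ck_on 0 S F\<close>] by simp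
    then have D: "(F has_derivative (\<lambda>h. fst h *\<^sub>R (F p ** A p) + snd h *\<^sub>R (F p ** B p))) (at p)"
      if "p \<in> S" for p
      using has_derivative_from_partials[OF S that Fx Ft] by blast
    show ?case
      by (rule Ck_on_SucI[OF S D])
        (auto intro!: Ck_on_add S Ck_on_linear[OF bounded_linear_scaleR_right S] mult Suc)
  qed
  then show ?thesis by (simp add: smooth_on_def)
qed

section \<open>The Riccati system of a KdV potential\<close>

lemma mat22_nth [simp]:
  "mat22 a b c d $ 1 $ 1 = a" "mat22 a b c d $ 1 $ 2 = b"
  "mat22 a b c d $ 2 $ 1 = c" "mat22 a b c d $ 2 $ 2 = d"
  by (simp_all add: mat22_def)

lemma mat22_eq_iff:
  fixes M N :: "'a ^ 2 ^ 2"
  shows "M = N \<longleftrightarrow> M $ 1 $ 1 = N $ 1 $ 1 \<and> M $ 1 $ 2 = N $ 1 $ 2 \<and> M $ 2 $ 1 = N $ 2 $ 1 \<and> M $ 2 $ 2 = N $ 2 $ 2"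
  by (auto simp: vec_eq_iff forall_2)

lemma matrix_mult_nth2:
  fixes M N :: "'a::comm_semiring_1 ^ 2 ^ 2"
  shows "(M ** N) $ i $ j = M $ i $ 1 * N $ 1 $ j + M $ i $ 2 * N $ 2 $ j"
  by (simp add: matrix_matrix_mult_def sum_2)

lemma smooth_on_DERIV_x:
  fixes f :: "real \<times> real \<Rightarrow> real"
  assumes "smooth_on S f" "p \<in> S"
  shows "((\<lambda>s. f (s, snd p)) has_field_derivative ddx f p) (at (fst p))"
  using ddx_eq(2)[OF smooth_on_has_derivative[OF assms]]
  by (simp add: has_real_derivative_iff_has_vector_derivative)

lemma smooth_on_DERIV_t:
  fixes f :: "real \<times> real \<Rightarrow> real"
  assumes "smooth_on S f" "p \<in> S"
  shows "((\<lambda>s. f (fst p, s)) has_field_derivative ddt f p) (at (snd p))"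
  using ddt_eq(2)[OF smooth_on_has_derivative[OF assms]]
  by (simp add: has_real_derivative_iff_has_vector_derivative)

lemma ddx_DERIV:
  fixes f :: "real \<times> real \<Rightarrow> real"
  shows "((\<lambda>s. f (s, snd p)) has_field_derivative D) (at (fst p)) \<Longrightarrow> ddx f p = D"
  unfolding ddx_def has_real_derivative_iff_has_vector_derivative by (rule vector_derivative_at)

lemma ddt_DERIV:
  fixes f :: "real \<times> real \<Rightarrow> real"
  shows "((\<lambda>s. f (fst p, s)) has_field_derivative D) (at (snd p)) \<Longrightarrow> ddt f p = D"
  unfolding ddt_def has_real_derivative_iff_has_vector_derivative by (rule vector_derivative_at)

lemma extended_frame_D:
  assumes "extended_frame_on S q E"
  shows "KdV_on S q" "smooth_on S (\<lambda>p. E p l)"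
    "p \<in> S \<Longrightarrow> det (E p l) = 1"
    "p \<in> S \<Longrightarrow> (\<lambda>l. E p l $ i $ j) holomorphic_on UNIV"
    "p \<in> S \<Longrightarrow> cnj (E p (cnj l) $ i $ j) = E p l $ i $ j"
    "p \<in> S \<Longrightarrow> ddx (\<lambda>p. E p l) p = E p l ** lax_x q p l"
    "p \<in> S \<Longrightarrow> ddt (\<lambda>p. E p l) p = E p l ** lax_t q p l"
  using assms unfolding extended_frame_on_def by blast+

lemma extended_frame_on_subset:
  assumes "extended_frame_on S q E" "T \<subseteq> S"
  shows "extended_frame_on T q E"
proof -
  note D = extended_frame_D[OF assms(1)]
  have sub: "p \<in> S" if "p \<in> T" for p
    using that assms(2) by blast
  have kdv: "ddt q p = 1/4 * (ddx (ddx (ddx q)) p - 6 * q p * ddx q p)" if "p \<in> S" for p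
    using D(1) that unfolding KdV_on_def by blast
  have "smooth_on S q"
    using D(1) unfolding KdV_on_def by blast
  then show ?thesis
    unfolding extended_frame_on_def KdV_on_def
    by (intro conjI ballI allI smooth_on_subset[OF assms(2)] D(2) kdv D(3-7) sub)
qed

lemma matrix_inv_unimodular:
  fixes M :: "complex ^ 2 ^ 2"
  assumes "det M = 1"
  shows "matrix_inv M = mat22 (M $ 2 $ 2) (- M $ 1 $ 2) (- M $ 2 $ 1) (M $ 1 $ 1)" (is "_ = ?N")
proof -
  have *: "M $ 1 $ 1 * M $ 2 $ 2 - M $ 1 $ 2 * M $ 2 $ 1 = 1"
    using assms by (simp add: det_2)
  have "M ** ?N = mat 1" "?N ** M = mat 1"
    using * by (simp_all add: mat22_eq_iff matrix_mult_nth2 mat_def algebra_simps)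
  then have "\<exists>N. M ** N = mat 1 \<and> N ** M = mat 1"
    by blast
  then have "M ** matrix_inv M = mat 1 \<and> matrix_inv M ** M = mat 1"
    unfolding matrix_inv_def by (rule someI_ex)
  then have inv: "matrix_inv M ** M = mat 1" ..
  have "matrix_inv M = matrix_inv M ** (M ** ?N)"
    unfolding \<open>M ** ?N = mat 1\<close> by simp
  also have "\<dots> = ?N"
    unfolding matrix_mul_assoc inv by simp
  finally show ?thesis .
qed

text \<open>The system solved by \<open>X = - y1 / y2\<close> for a solution \<open>y\<close>, with \<open>y2\<close> nowhere zero, of the dual linear system
  \<open>y_x = - A y\<close>, \<open>y_t = - B y\<close> with Lax matrices \<open>A\<close>, \<open>B\<close> taken at \<open>k\<^sup>2\<close>: this is the projective form of
  that system.\<close>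

definition riccati_system_on ::
  "(real \<times> real) set \<Rightarrow> (real \<times> real \<Rightarrow> real) \<Rightarrow> real \<Rightarrow> (real \<times> real \<Rightarrow> real) \<Rightarrow> bool" where
  "riccati_system_on S q k X \<longleftrightarrow>
     smooth_on S X \<and>
     (\<forall>p\<in>S. ddx X p = q p + k ^ 2 - (X p) ^ 2) \<and>
     (\<forall>p\<in>S. ddt X p = k ^ 4 + q p * k ^ 2 / 2 + (ddx (ddx q) p - 2 * (q p) ^ 2) / 4
        - ddx q p * X p / 2 - (k ^ 2 - q p / 2) * (X p) ^ 2)"

lemma riccati_system_onD:
  assumes "riccati_system_on S q k X"
  shows "smooth_on S X"
    and "p \<in> S \<Longrightarrow> ddx X p = q p + k ^ 2 - (X p) ^ 2"
    and "p \<in> S \<Longrightarrow> ddt X p = k ^ 4 + q p * k ^ 2 / 2 + (ddx (ddx q) p - 2 * (q p) ^ 2) / 4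
        - ddx q p * X p / 2 - (k ^ 2 - q p / 2) * (X p) ^ 2"
  using assms unfolding riccati_system_on_def by blast+

text \<open>The field is \<open>X = w / v\<close> with \<open>(v, w) = (1, \<xi>) E\<close> at \<open>k\<^sup>2\<close>. The inverse of a unimodular matrix is its adjugate,
  which gives \<open>y = (- w, v)\<close>, and the rows of \<open>E\<close> solve the Lax system. The last conjunct, \<open>w = X v\<close>, is what
  makes the transformed frame regular at \<open>k\<^sup>2\<close>.\<close>

lemma riccati_solution:
  assumes frame: "extended_frame_on UNIV q E" and \<Omega>: "open \<Omega>"
    and y_def: "\<And>p. y p = matrix_inv (E p (complex_of_real (k ^ 2))) *v vector [- complex_of_real \<xi>, 1]"
    and y2: "\<forall>p\<in>\<Omega>. y p $ 2 \<noteq> 0"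
  shows "\<exists>X. riccati_system_on \<Omega> q k X \<and>
    (\<forall>p\<in>\<Omega>. complex_of_real (X p) = - (y p $ 1 / y p $ 2)) \<and>
    (\<forall>p\<in>\<Omega>. E p (complex_of_real (k ^ 2)) $ 1 $ 2 + complex_of_real \<xi> * E p (complex_of_real (k ^ 2)) $ 2 $ 2
      = complex_of_real (X p) * (E p (complex_of_real (k ^ 2)) $ 1 $ 1
          + complex_of_real \<xi> * E p (complex_of_real (k ^ 2)) $ 2 $ 1))"
proof -
  define c where "c = k ^ 2"
  let ?a = "complex_of_real c"
  define e where "e i j p = Re (E p ?a $ i $ j)" for i j p
  \<comment> \<open>The reality condition at the real point \<open>k\<^sup>2\<close>, which is its own conjugate.\<close>
  have E_real: "E p ?a $ i $ j = of_real (e i j p)" for p i j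
    using extended_frame_D(5)[OF frame, of p ?a i j] unfolding e_def
    by (simp add: complex_eq_iff)
  have e_smooth: "smooth_on UNIV (e i j)" for i j
    unfolding e_def by (intro smooth_on_Re smooth_on_nth extended_frame_D(2)[OF frame] open_UNIV)
  have ex: "ddx (e i 1) p = e i 2 p" "ddx (e i 2) p = (c + q p) * e i 1 p" 
    and et: "ddt (e i 1) p = e i 1 p * (1/4 * ddx q p) + e i 2 p * (c - q p / 2)"
    "ddt (e i 2) p = e i 1 p * (c ^ 2 + q p * c / 2 + (ddx (ddx q) p - 2 * (q p) ^ 2) / 4)
      - e i 2 p * (1/4 * ddx q p)" for i p
  proof -
    have "((\<lambda>p. Re (E p ?a $ i $ j)) has_derivative (\<lambda>h. Re ((fst h *\<^sub>R (E p ?a ** lax_x q p ?a)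
        + snd h *\<^sub>R (E p ?a ** lax_t q p ?a)) $ i $ j))) (at p)" for j
      using smooth_on_has_derivative[OF extended_frame_D(2)[OF frame], of p ?a]
        extended_frame_D(6,7)[OF frame, of p ?a]
      by (intro bounded_linear.has_derivative[OF bounded_linear_Re]
          bounded_linear.has_derivative[OF bounded_linear_vec_nth]) auto
    then have D: "(e i j has_derivative (\<lambda>h. Re ((fst h *\<^sub>R (E p ?a ** lax_x q p ?a)
        + snd h *\<^sub>R (E p ?a ** lax_t q p ?a)) $ i $ j))) (at p)" for j
      unfolding e_def .
    show "ddx (e i 1) p = e i 2 p" "ddx (e i 2) p = (c + q p) * e i 1 p"
      using ddx_eq(1)[OF D] by (simp_all add: matrix_mult_nth2 E_real lax_x_def)
    show "ddt (e i 1) p = e i 1 p * (1/4 * ddx q p) + e i 2 p * (c - q p / 2)"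
      "ddt (e i 2) p = e i 1 p * (c ^ 2 + q p * c / 2 + (ddx (ddx q) p - 2 * (q p) ^ 2) / 4)
        - e i 2 p * (1/4 * ddx q p)"
      using ddt_eq(1)[OF D]
      by (simp_all add: matrix_mult_nth2 E_real lax_t_def power2_eq_square)
  qed
  define v where "v p = e 1 1 p + \<xi> * e 2 1 p" for p
  define w where "w p = e 1 2 p + \<xi> * e 2 2 p" for p
  define X where "X p = w p / v p" for p
  have vw_smooth: "smooth_on UNIV v" "smooth_on UNIV w"
    unfolding v_def w_def by (intro smooth_on_add smooth_on_mult smooth_on_const e_smooth open_UNIV)+
  have lines: "ddx v p = w p" "ddx w p = (c + q p) * v p"
    "ddt v p = v p * (1/4 * ddx q p) + w p * (c - q p / 2)"
    "ddt w p = v p * (c ^ 2 + q p * c / 2 + (ddx (ddx q) p - 2 * (q p) ^ 2) / 4) - w p * (1/4 * ddx q p)"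
    for p
  proof -
    note D = smooth_on_DERIV_x[OF e_smooth UNIV_I] smooth_on_DERIV_t[OF e_smooth UNIV_I]
    show "ddx v p = w p"
      unfolding v_def w_def
      by (rule ddx_DERIV) (rule derivative_eq_intros D refl | simp add: ex)+
    show "ddx w p = (c + q p) * v p"
      unfolding v_def w_def
      by (rule ddx_DERIV) (rule derivative_eq_intros D refl | simp add: ex algebra_simps)+
    show "ddt v p = v p * (1/4 * ddx q p) + w p * (c - q p / 2)"
      unfolding v_def w_def
      by (rule ddt_DERIV) (rule derivative_eq_intros D refl | simp add: et algebra_simps)+
    show "ddt w p = v p * (c ^ 2 + q p * c / 2 + (ddx (ddx q) p - 2 * (q p) ^ 2) / 4) - w p * (1/4 * ddx q p)"
      unfolding v_def w_def
      by (rule ddt_DERIV) (rule derivative_eq_intros D refl | simp add: et field_simps)+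
  qed
  have y: "y p $ 1 = - of_real (w p)" "y p $ 2 = of_real (v p)" for p
    unfolding y_def v_def w_def c_def[symmetric]
    by (simp_all add: matrix_inv_unimodular[OF extended_frame_D(3)[OF frame UNIV_I]]
        matrix_vector_mult_def sum_2 E_real algebra_simps)
  have v: "v p \<noteq> 0" if "p \<in> \<Omega>" for p
    using y2 that by (simp add: y)
  have X_smooth: "smooth_on \<Omega> X"
    unfolding X_def by (intro smooth_on_divide \<Omega> v smooth_on_subset[OF subset_UNIV vw_smooth(1)]
        smooth_on_subset[OF subset_UNIV vw_smooth(2)])
  show ?thesis
    unfolding riccati_system_on_def
  proof (intro exI[of _ X] conjI ballI X_smooth)
    fix p assume p: "p \<in> \<Omega>"
    note [derivative_intros] = smooth_on_DERIV_x[OF vw_smooth(1) UNIV_I] smooth_on_DERIV_x[OF vw_smooth(2) UNIV_I]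
      smooth_on_DERIV_t[OF vw_smooth(1) UNIV_I] smooth_on_DERIV_t[OF vw_smooth(2) UNIV_I]
    show "complex_of_real (X p) = - (y p $ 1 / y p $ 2)"
      by (simp add: y X_def)
    have "ddx X p = (ddx w p * v p - w p * ddx v p) / (v p * v p)"
      unfolding X_def using v[OF p] by (intro ddx_DERIV) (auto intro!: derivative_eq_intros)
    then show "ddx X p = q p + k ^ 2 - (X p) ^ 2"
      using v[OF p] by (simp add: lines X_def c_def power4_eq_xxxx field_simps power2_eq_square)
    have wX: "w p = X p * v p"
      using v[OF p] by (simp add: X_def)
    have "ddt X p = (ddt w p * v p - w p * ddt v p) / (v p * v p)"
      unfolding X_def using v[OF p] by (intro ddt_DERIV) (auto intro!: derivative_eq_intros)
    then have "ddt X p * (v p * v p) = ddt w p * v p - w p * ddt v p"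
      using v[OF p] by simp
    also have "\<dots> = (k ^ 4 + q p * k ^ 2 / 2 + (ddx (ddx q) p - 2 * (q p) ^ 2) / 4
        - ddx q p * X p / 2 - (k ^ 2 - q p / 2) * (X p) ^ 2) * (v p * v p)"
      unfolding lines wX c_def by algebra
    finally show "ddt X p = k ^ 4 + q p * k ^ 2 / 2 + (ddx (ddx q) p - 2 * (q p) ^ 2) / 4
        - ddx q p * X p / 2 - (k ^ 2 - q p / 2) * (X p) ^ 2"
      using v[OF p] by simp
    show "E p (complex_of_real (k ^ 2)) $ 1 $ 2 + complex_of_real \<xi> * E p (complex_of_real (k ^ 2)) $ 2 $ 2
        = complex_of_real (X p) * (E p (complex_of_real (k ^ 2)) $ 1 $ 1 + complex_of_real \<xi> * E p (complex_of_real (k ^ 2)) $ 2 $ 1)"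
      unfolding c_def[symmetric] using wX by (simp add: E_real v_def w_def flip: of_real_mult of_real_add)
  qed
qed

text \<open>With \<open>P = q + k\<^sup>2 - X\<^sup>2 = X_x\<close> one has \<open>P_x = q_x - 2 X P\<close>, so every \<open>x\<close>-derivative of \<open>Q\<close> is a polynomial in
  \<open>X\<close> and the \<open>x\<close>-derivatives of \<open>q\<close>. After substitution of the KdV equation for \<open>q_t\<close>, the KdV equation for \<open>Q\<close>
  is a polynomial identity.\<close>

lemma transformed_potential:
  fixes q X :: "real \<times> real \<Rightarrow> real"
  assumes \<Omega>: "open \<Omega>" and kdv: "KdV_on \<Omega> q" and ric: "riccati_system_on \<Omega> q k X"
  defines "Q \<equiv> \<lambda>p. - q p + 2 * ((X p) ^ 2 - k ^ 2)"
  shows "\<And>p. p \<in> \<Omega> \<Longrightarrow> ddx Q p = - ddx q p + 4 * X p * (q p + k ^ 2 - (X p) ^ 2)"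
    and "\<And>p. p \<in> \<Omega> \<Longrightarrow> ddx (ddx Q) p = - ddx (ddx q) p + 4 * (q p + k ^ 2 - (X p) ^ 2) ^ 2
        + 4 * X p * (ddx q p - 2 * X p * (q p + k ^ 2 - (X p) ^ 2))"
    and "KdV_on \<Omega> Q"
proof -
  note X = riccati_system_onD(1)[OF ric] and Xx = riccati_system_onD(2)[OF ric]
    and Xt = riccati_system_onD(3)[OF ric]
  have q: "smooth_on \<Omega> q" and q_t: "p \<in> \<Omega> \<Longrightarrow> ddt q p = 1/4 * (ddx (ddx (ddx q)) p - 6 * q p * ddx q p)" for p
    using kdv by (auto simp: KdV_on_def)
  note qx = smooth_on_ddx[OF \<Omega> q]
  note qxx = smooth_on_ddx[OF \<Omega> qx]
  note DX = smooth_on_DERIV_x[OF X] smooth_on_DERIV_x[OF q] smooth_on_DERIV_x[OF qx] smooth_on_DERIV_x[OF qxx]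
  show Q1: "ddx Q p = - ddx q p + 4 * X p * (q p + k ^ 2 - (X p) ^ 2)" if "p \<in> \<Omega>" for p
    unfolding Q_def
    by (rule ddx_DERIV, (rule derivative_eq_intros DX refl that | simp add: Xx[OF that])+)
  have "ddx (ddx Q) p = - ddx (ddx q) p + 4 * (q p + k ^ 2 - (X p) ^ 2) ^ 2
      + 4 * X p * (ddx q p - 2 * X p * (q p + k ^ 2 - (X p) ^ 2))" if "p \<in> \<Omega>" for p
  proof -
    have "ddx (ddx Q) p = ddx (\<lambda>p. - ddx q p + 4 * X p * (q p + k ^ 2 - (X p) ^ 2)) p"
      by (rule ddx_cong[OF \<Omega> that Q1])
    also have "\<dots> = - ddx (ddx q) p + 4 * (q p + k ^ 2 - (X p) ^ 2) ^ 2
      + 4 * X p * (ddx q p - 2 * X p * (q p + k ^ 2 - (X p) ^ 2))"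
      by (rule ddx_DERIV) (rule derivative_eq_intros DX refl that | simp add: Xx[OF that] algebra_simps power2_eq_square)+
    finally show ?thesis .
  qed
  note Q2 = this
  show "ddx (ddx Q) p = - ddx (ddx q) p + 4 * (q p + k ^ 2 - (X p) ^ 2) ^ 2
      + 4 * X p * (ddx q p - 2 * X p * (q p + k ^ 2 - (X p) ^ 2))" if "p \<in> \<Omega>" for p
    by (rule Q2[OF that])
  have Q3: "ddx (ddx (ddx Q)) p = - ddx (ddx (ddx q)) p
      + 12 * (q p + k ^ 2 - (X p) ^ 2) * (ddx q p - 2 * X p * (q p + k ^ 2 - (X p) ^ 2))
      + 4 * X p * (ddx (ddx q) p - 2 * (q p + k ^ 2 - (X p) ^ 2) ^ 2
        - 2 * X p * (ddx q p - 2 * X p * (q p + k ^ 2 - (X p) ^ 2)))" if "p \<in> \<Omega>" for p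
  proof -
    have "ddx (ddx (ddx Q)) p = ddx (\<lambda>p. - ddx (ddx q) p + 4 * (q p + k ^ 2 - (X p) ^ 2) ^ 2
        + 4 * X p * (ddx q p - 2 * X p * (q p + k ^ 2 - (X p) ^ 2))) p"
      by (rule ddx_cong[OF \<Omega> that Q2])
    also have "\<dots> = - ddx (ddx (ddx q)) p
      + 12 * (q p + k ^ 2 - (X p) ^ 2) * (ddx q p - 2 * X p * (q p + k ^ 2 - (X p) ^ 2))
      + 4 * X p * (ddx (ddx q) p - 2 * (q p + k ^ 2 - (X p) ^ 2) ^ 2
        - 2 * X p * (ddx q p - 2 * X p * (q p + k ^ 2 - (X p) ^ 2)))"
      by (rule ddx_DERIV) (rule derivative_eq_intros DX refl that | simp add: Xx[OF that] algebra_simps power2_eq_square)+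
    finally show ?thesis .
  qed
  have Qt: "ddt Q p = - ddt q p + 4 * X p * ddt X p" if "p \<in> \<Omega>" for p
    unfolding Q_def
    by (rule ddt_DERIV, (rule derivative_eq_intros smooth_on_DERIV_t[OF X] smooth_on_DERIV_t[OF q] refl that | simp)+)
  have "smooth_on \<Omega> Q"
    unfolding Q_def by (intro smooth_intros \<Omega> q X)
  moreover have "ddt Q p = 1/4 * (ddx (ddx (ddx Q)) p - 6 * Q p * ddx Q p)" if "p \<in> \<Omega>" for p
    unfolding Qt[OF that] Q3[OF that] Q1[OF that] q_t[OF that] Xt[OF that] unfolding Q_def
    by algebra
  ultimately show "KdV_on \<Omega> Q"
    by (simp add: KdV_on_def)
qed

section \<open>The transformed curve\<close>

text \<open>Let \<open>\<Gamma>\<close> be the new curve. The Riccati equation gives \<open>k \<Gamma>_x = (k\<^sup>2 - X\<^sup>2) \<gamma> + X \<gamma>_x\<close>, so both \<open>\<Gamma>\<close> and \<open>\<Gamma>_x\<close> are combinations of \<open>\<gamma>\<close> and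
  \<open>\<gamma>_x\<close>, and the matrix of coefficients has determinant 1. Each claim then follows by comparing the coefficients of
  \<open>\<gamma>\<close> and \<open>\<gamma>_x\<close>.\<close>

lemma transformed_curve:
  fixes q X :: "real \<times> real \<Rightarrow> real" and \<gamma> :: "real \<times> real \<Rightarrow> real ^ 2"
  assumes \<Omega>: "open \<Omega>" and flow: "central_affine_curve_flow_on UNIV \<gamma> q" and k: "k \<noteq> 0"
    and kdv: "KdV_on \<Omega> q" and ric: "riccati_system_on \<Omega> q k X"
  shows "central_affine_curve_flow_on \<Omega> (\<lambda>p. (1 / k) *\<^sub>R (X p *\<^sub>R \<gamma> p - ddx \<gamma> p))
    (\<lambda>p. - q p + 2 * ((X p) ^ 2 - k ^ 2))"
proof -
  note X = riccati_system_onD(1)[OF ric] and Xx = riccati_system_onD(2)[OF ric]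
    and Xt = riccati_system_onD(3)[OF ric]
  define c where "c = 1 / k"
  have ck: "c * k = 1"
    using k by (simp add: c_def)
  define Q where "Q = (\<lambda>p. - q p + 2 * ((X p) ^ 2 - k ^ 2))"
  define \<Gamma> where "\<Gamma> = (\<lambda>p. c *\<^sub>R (X p *\<^sub>R \<gamma> p - ddx \<gamma> p))"
  have Q_kdv: "KdV_on \<Omega> Q"
    unfolding Q_def by (rule transformed_potential(3)[OF \<Omega> kdv ric])
  have Qx: "ddx Q p = - ddx q p + 4 * X p * (q p + k ^ 2 - (X p) ^ 2)" if "p \<in> \<Omega>" for p
    unfolding Q_def by (rule transformed_potential(1)[OF \<Omega> kdv ric that])
  have \<gamma>: "smooth_on UNIV \<gamma>" and q: "smooth_on UNIV q"
    and det: "det (col_mat (\<gamma> p) (ddx \<gamma> p)) = 1"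
    and \<gamma>xx: "ddx (ddx \<gamma>) p = q p *\<^sub>R \<gamma> p"
    and \<gamma>t: "ddt \<gamma> p = (1/4 * ddx q p) *\<^sub>R \<gamma> p - (1/2 * q p) *\<^sub>R ddx \<gamma> p" for p
    using flow unfolding central_affine_curve_flow_on_def central_affine_curvature_on_def by blast+
  note \<gamma>x = smooth_on_ddx[OF open_UNIV \<gamma>] and qx = smooth_on_ddx[OF open_UNIV q]
  note line_x = ddx_eq(2)[OF smooth_on_has_derivative[OF \<gamma> UNIV_I], simplified]
    ddx_eq(2)[OF smooth_on_has_derivative[OF \<gamma>x UNIV_I], simplified]
    smooth_on_DERIV_x[OF q UNIV_I] smooth_on_DERIV_x[OF qx UNIV_I] smooth_on_DERIV_x[OF X]
  note line_t = ddt_eq(2)[OF smooth_on_has_derivative[OF \<gamma> UNIV_I], simplified]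
    ddt_eq(2)[OF smooth_on_has_derivative[OF \<gamma>x UNIV_I], simplified] smooth_on_DERIV_t[OF X]
  \<comment> \<open>The flow equation differentiated in \<open>x\<close>, with \<open>\<gamma>_xx = q \<gamma>\<close> inserted.\<close>
  have \<gamma>xt: "ddt (ddx \<gamma>) p = (1/4 * ddx (ddx q) p - 1/2 * (q p) ^ 2) *\<^sub>R \<gamma> p - (1/4 * ddx q p) *\<^sub>R ddx \<gamma> p" for p
  proof -
    have "ddt (ddx \<gamma>) p = ddx (\<lambda>p. (1/4 * ddx q p) *\<^sub>R \<gamma> p - (1/2 * q p) *\<^sub>R ddx \<gamma> p) p"
      unfolding ddt_ddx_commute[OF \<gamma>] using \<gamma>t by presburger
    also have "\<dots> = ((1/4 * ddx q p) *\<^sub>R ddx \<gamma> p + (1/4 * ddx (ddx q) p) *\<^sub>R \<gamma> p)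
        - ((1/2 * q p) *\<^sub>R ddx (ddx \<gamma>) p + (1/2 * ddx q p) *\<^sub>R ddx \<gamma> p)"
      unfolding ddx_def[of "\<lambda>p. (1/4 * ddx q p) *\<^sub>R \<gamma> p - (1/2 * q p) *\<^sub>R ddx \<gamma> p"]
      by (rule vector_derivative_at)
        (auto intro!: derivative_eq_intros line_x)
    finally show ?thesis
      by (simp add: \<gamma>xx vec_eq_iff power2_eq_square algebra_simps)
  qed
  have \<Gamma>x: "ddx \<Gamma> p = c *\<^sub>R ((k ^ 2 - (X p) ^ 2) *\<^sub>R \<gamma> p + X p *\<^sub>R ddx \<gamma> p)" if p: "p \<in> \<Omega>" for p
  proof -
    have "ddx \<Gamma> p = c *\<^sub>R (X p *\<^sub>R ddx \<gamma> p + ddx X p *\<^sub>R \<gamma> p - ddx (ddx \<gamma>) p)"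
      unfolding ddx_def[of \<Gamma>] unfolding \<Gamma>_def
      by (rule vector_derivative_at)
        (auto intro!: derivative_eq_intros line_x p)
    then show ?thesis
      by (simp add: \<gamma>xx Xx[OF p] algebra_simps)
  qed
  have \<Gamma>xx: "ddx (ddx \<Gamma>) p = Q p *\<^sub>R \<Gamma> p" if p: "p \<in> \<Omega>" for p
  proof -
    have "ddx (ddx \<Gamma>) p = ddx (\<lambda>p. c *\<^sub>R ((k ^ 2 - (X p) ^ 2) *\<^sub>R \<gamma> p + X p *\<^sub>R ddx \<gamma> p)) p"
      by (rule ddx_cong[OF \<Omega> p \<Gamma>x])
    also have "\<dots> = c *\<^sub>R (((k ^ 2 - (X p) ^ 2) *\<^sub>R ddx \<gamma> p + (- (2 * X p * ddx X p)) *\<^sub>R \<gamma> p)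
        + (X p *\<^sub>R ddx (ddx \<gamma>) p + ddx X p *\<^sub>R ddx \<gamma> p))"
      unfolding ddx_def[of "\<lambda>p. c *\<^sub>R ((k ^ 2 - (X p) ^ 2) *\<^sub>R \<gamma> p + X p *\<^sub>R ddx \<gamma> p)"]
      by (rule vector_derivative_at)
        (auto intro!: derivative_eq_intros line_x p)
    also have "\<dots> = Q p *\<^sub>R \<Gamma> p"
      by (simp add: \<gamma>xx Xx[OF p] Q_def \<Gamma>_def vec_eq_iff field_simps power2_eq_square)
    finally show ?thesis .
  qed
  have \<Gamma>t: "ddt \<Gamma> p = (1/4 * ddx Q p) *\<^sub>R \<Gamma> p - (1/2 * Q p) *\<^sub>R ddx \<Gamma> p" if p: "p \<in> \<Omega>" for p
  proof -
    have "ddt \<Gamma> p = c *\<^sub>R (X p *\<^sub>R ddt \<gamma> p + ddt X p *\<^sub>R \<gamma> p - ddt (ddx \<gamma>) p)"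
      unfolding ddt_def[of \<Gamma>] unfolding \<Gamma>_def
      by (rule vector_derivative_at)
        (auto intro!: derivative_eq_intros line_t p)
    also have "\<dots> = (1/4 * ddx Q p) *\<^sub>R \<Gamma> p - (1/2 * Q p) *\<^sub>R ddx \<Gamma> p"
      unfolding \<gamma>t \<gamma>xt Xt[OF p] Qx[OF p] \<Gamma>x[OF p] unfolding Q_def \<Gamma>_def vec_eq_iff
        vector_scaleR_component vector_minus_component vector_add_component real_scaleR_def
      by (simp add: field_simps power2_eq_square power4_eq_xxxx)
    finally show ?thesis .
  qed
  have \<Gamma>_smooth: "smooth_on \<Omega> \<Gamma>"
    unfolding \<Gamma>_def
    by (intro smooth_on_scaleR smooth_on_diff smooth_on_const \<Omega> X
        smooth_on_subset[OF subset_UNIV \<gamma>] smooth_on_subset[OF subset_UNIV \<gamma>x])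
  have \<Gamma>_det: "det (col_mat (\<Gamma> p) (ddx \<Gamma> p)) = 1" if p: "p \<in> \<Omega>" for p
  proof -
    have d: "\<gamma> p $ 1 * ddx \<gamma> p $ 2 - ddx \<gamma> p $ 1 * \<gamma> p $ 2 = 1"
      using det[of p] by (simp add: det_2 col_mat_def)
    have "det (col_mat (\<Gamma> p) (ddx \<Gamma> p)) = c ^ 2 * k ^ 2 * (\<gamma> p $ 1 * ddx \<gamma> p $ 2 - ddx \<gamma> p $ 1 * \<gamma> p $ 2)"
      unfolding \<Gamma>x[OF p] unfolding \<Gamma>_def det_2 col_mat_def mat22_nth
        vector_scaleR_component vector_minus_component vector_add_component real_scaleR_def
      by algebra
    then show ?thesis using d ck by (simp flip: power_mult_distrib)
  qed
  have "\<Gamma> p \<noteq> 0" if "p \<in> \<Omega>" for p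
    using \<Gamma>_det[OF that] by (auto simp: det_2 col_mat_def)
  then have "central_affine_curve_flow_on \<Omega> \<Gamma> Q"
    using \<Gamma>_smooth \<Gamma>_det \<Gamma>xx \<Gamma>t Q_kdv
    by (simp add: central_affine_curve_flow_on_def central_affine_curvature_on_def KdV_on_def)
  then show ?thesis
    unfolding \<Gamma>_def Q_def c_def .
qed

section \<open>The transformed frame\<close>

lemma smooth_on_mat22:
  fixes a b c d :: "'a::real_normed_vector \<Rightarrow> 'b::real_normed_vector"
  assumes "open S" "smooth_on S a" "smooth_on S b" "smooth_on S c" "smooth_on S d"
  shows "smooth_on S (\<lambda>p. mat22 (a p) (b p) (c p) (d p))"
proof (intro smooth_on_vecI assms(1))
  show "smooth_on S (\<lambda>p. mat22 (a p) (b p) (c p) (d p) $ i $ j)" for i j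
    using exhaust_2[of i] exhaust_2[of j] assms(2-) by auto
qed

lemma continuous_on_mat22:
  fixes a b c d :: "'a::topological_space \<Rightarrow> 'b::real_normed_vector"
  assumes "continuous_on S a" "continuous_on S b" "continuous_on S c" "continuous_on S d"
  shows "continuous_on S (\<lambda>p. mat22 (a p) (b p) (c p) (d p))"
proof -
  have "mat22 (a p) (b p) (c p) (d p) =
      (\<chi> i j. if i = 1 then (if j = 1 then a p else b p) else (if j = 1 then c p else d p))" for p
    by (simp add: mat22_eq_iff)
  moreover have "continuous_on S (\<lambda>p. (\<chi> i j. if i = 1 then (if j = 1 then a p else b p)
      else (if j = 1 then c p else d p)) :: 'b ^ 2 ^ 2)"
  proof (intro continuous_on_vec_lambda)
    fix i j :: 2
    show "continuous_on S (\<lambda>p. if i = 1 then (if j = 1 then a p else b p)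
      else (if j = 1 then c p else d p))"
      using assms by (cases "i = 1"; cases "j = 1") simp_all
  qed
  ultimately show ?thesis by simp
qed

lemma lax_smooth:
  assumes "open S" "smooth_on S q"
  shows "smooth_on S (\<lambda>p. lax_x q p l)" "smooth_on S (\<lambda>p. lax_t q p l)"
proof -
  have "smooth_on S (ddx q)" "smooth_on S (ddx (ddx q))"
    by (intro smooth_on_ddx assms)+
  then show "smooth_on S (\<lambda>p. lax_x q p l)" "smooth_on S (\<lambda>p. lax_t q p l)"
    unfolding lax_x_def lax_t_def divide_inverse
    by (intro smooth_on_mat22 smooth_on_const smooth_on_of_real smooth_on_add smooth_on_diff
        smooth_on_mult smooth_on_power assms)+
qed

text \<open>Joint continuity in the path parameter and in \<open>\<lambda>\<close> is what \<open>linear_system_limit\<close> asks of its coefficients;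
  there \<open>c\<close> runs along a coordinate line.\<close>

lemma lax_continuous:
  assumes "open S" "smooth_on S q" "\<And>z. z \<in> Z \<Longrightarrow> c z \<in> S" "continuous_on Z c"
  shows "continuous_on (UNIV \<times> Z) (\<lambda>z. lax_x q (c (snd z)) (fst z))"
    and "continuous_on (UNIV \<times> Z) (\<lambda>z. lax_t q (c (snd z)) (fst z))"
proof -
  have c: "continuous_on (UNIV \<times> Z) (\<lambda>z. f (c (snd z)))" if "smooth_on S f" for f :: "real \<times> real \<Rightarrow> real"
    by (rule continuous_on_compose2[OF smooth_on_imp_continuous_on[OF that]])
      (auto intro!: continuous_on_compose2[OF assms(4)] continuous_on_snd continuous_on_id simp: assms(3))
  note c' = c[OF assms(2)] c[OF smooth_on_ddx[OF assms(1,2)]]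
    c[OF smooth_on_ddx[OF assms(1) smooth_on_ddx[OF assms(1,2)]]]
  show "continuous_on (UNIV \<times> Z) (\<lambda>z. lax_x q (c (snd z)) (fst z))"
    and "continuous_on (UNIV \<times> Z) (\<lambda>z. lax_t q (c (snd z)) (fst z))"
    unfolding lax_x_def lax_t_def
    by (intro continuous_on_mat22 continuous_intros c')+ auto
qed

text \<open>With constant matrices split off, derivatives of the gauge matrix reduce to derivatives of \<open>X\<close> and \<open>X\<^sup>2\<close>.\<close>

lemma gauge_matrix_decomposition:
  "r_mat (- X) k l = mat22 0 (l - of_real (k ^ 2)) 1 0 + X *\<^sub>R mat22 (- 1) 0 0 (- 1) + (X ^ 2) *\<^sub>R mat22 0 1 0 0"
  by (simp add: mat22_eq_iff r_mat_def scaleR_conv_of_real[where 'a=complex])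

text \<open>The second summand on each left-hand side is the derivative of the gauge matrix \<open>R\<close>, read off from the
  decomposition above. The identities say that \<open>E R\<close> solves the Lax system of \<open>Q\<close> whenever \<open>E\<close> solves that of \<open>q\<close>.\<close>

lemma gauge_identities:
  fixes q X :: "real \<times> real \<Rightarrow> real"
  assumes \<Omega>: "open \<Omega>" and kdv: "KdV_on \<Omega> q" and ric: "riccati_system_on \<Omega> q k X"
    and p: "p \<in> \<Omega>"
  defines "Q \<equiv> \<lambda>p. - q p + 2 * ((X p) ^ 2 - k ^ 2)"
  shows "lax_x q p l ** r_mat (- X p) k l + (ddx X p *\<^sub>R mat22 (- 1) 0 0 (- 1) + (2 * X p * ddx X p) *\<^sub>R mat22 0 1 0 0)
      = r_mat (- X p) k l ** lax_x Q p l"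
    and "lax_t q p l ** r_mat (- X p) k l + (ddt X p *\<^sub>R mat22 (- 1) 0 0 (- 1) + (2 * X p * ddt X p) *\<^sub>R mat22 0 1 0 0)
      = r_mat (- X p) k l ** lax_t Q p l"
proof -
  note Xx = riccati_system_onD(2)[OF ric p] and Xt = riccati_system_onD(3)[OF ric p]
  have Qx: "ddx Q p = - ddx q p + 4 * X p * (q p + k ^ 2 - (X p) ^ 2)"
    unfolding Q_def by (rule transformed_potential(1)[OF \<Omega> kdv ric p])
  have Qxx: "ddx (ddx Q) p = - ddx (ddx q) p + 4 * (q p + k ^ 2 - (X p) ^ 2) ^ 2
      + 4 * X p * (ddx q p - 2 * X p * (q p + k ^ 2 - (X p) ^ 2))"
    unfolding Q_def by (rule transformed_potential(2)[OF \<Omega> kdv ric p])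
  note expand = mat22_eq_iff matrix_mult_nth2 vector_add_component vector_scaleR_component
    mat22_nth scaleR_conv_of_real[where 'a=complex] zero_index
    of_real_add of_real_mult of_real_diff of_real_minus of_real_power of_real_divide of_real_numeral of_real_1
  show "lax_x q p l ** r_mat (- X p) k l + (ddx X p *\<^sub>R mat22 (- 1) 0 0 (- 1) + (2 * X p * ddx X p) *\<^sub>R mat22 0 1 0 0)
      = r_mat (- X p) k l ** lax_x Q p l"
    unfolding lax_x_def r_mat_def Xx Q_def
    by (simp add: expand power2_eq_square algebra_simps)
  show "lax_t q p l ** r_mat (- X p) k l + (ddt X p *\<^sub>R mat22 (- 1) 0 0 (- 1) + (2 * X p * ddt X p) *\<^sub>R mat22 0 1 0 0)
      = r_mat (- X p) k l ** lax_t Q p l"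
    unfolding lax_t_def r_mat_def Xt Qx Qxx unfolding Q_def
    by (simp add: expand power2_eq_square power4_eq_xxxx field_simps)
qed

text \<open>Away from \<open>k\<^sup>2\<close> everything is gauge covariance and multiplicativity of the determinant. At \<open>k\<^sup>2\<close> the extended
  frame is a limit of its values at the real points \<open>k\<^sup>2 + 1 / (n + 1)\<close>, which carries over the linear
  system, the determinant and the reality condition.\<close>

lemma transformed_frame:
  fixes q X :: "real \<times> real \<Rightarrow> real"
  assumes \<Omega>: "open \<Omega>" and frame: "extended_frame_on \<Omega> q E" and ric: "riccati_system_on \<Omega> q k X"
    and kernel: "\<forall>p\<in>\<Omega>.
      E p (complex_of_real (k ^ 2)) $ 1 $ 2 + complex_of_real \<xi> * E p (complex_of_real (k ^ 2)) $ 2 $ 2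
      = complex_of_real (X p) * (E p (complex_of_real (k ^ 2)) $ 1 $ 1
          + complex_of_real \<xi> * E p (complex_of_real (k ^ 2)) $ 2 $ 1)"
  shows "\<exists>Et. extended_frame_on \<Omega> (\<lambda>p. - q p + 2 * ((X p) ^ 2 - k ^ 2)) Et \<and>
    (\<forall>p\<in>\<Omega>. \<forall>l. l \<noteq> complex_of_real (k ^ 2) \<longrightarrow>
      Et p l = (\<chi> i j. (r_mat \<xi> k l ** E p l ** r_mat (- X p) k l) $ i $ j / (l - complex_of_real (k ^ 2))))"
proof -
  note X = riccati_system_onD(1)[OF ric]
  define a where "a = complex_of_real (k ^ 2)"
  define Q where "Q = (\<lambda>p. - q p + 2 * ((X p) ^ 2 - k ^ 2))"
  define C where "C p l = r_mat \<xi> k l ** E p l ** r_mat (- X p) k l" for p l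
  \<comment> \<open>The quotient by \<open>l - a\<close>, with its removable singularity at \<open>a\<close> filled in.\<close>
  define F where "F p l = (\<chi> i j. if l = a then deriv (\<lambda>l. C p l $ i $ j) a else C p l $ i $ j / (l - a))" for p l
  have kdv: "KdV_on \<Omega> q" by (rule extended_frame_D(1)[OF frame])
  have Q_kdv: "KdV_on \<Omega> Q"
    unfolding Q_def by (rule transformed_potential(3)[OF \<Omega> kdv ric])
  then have Q: "smooth_on \<Omega> Q" by (simp add: KdV_on_def)

  \<comment> \<open>Both outer factors have rank one at \<open>a\<close>; the inner product that remains is \<open>w - X v\<close>.\<close>
  have C_zero: "C p a $ i $ j = 0" if "p \<in> \<Omega>" for p i j
  proof -
    note k0 = bspec[OF kernel that, folded a_def]
    have r: "r_mat c k a = mat22 (of_real c) (of_real c ^ 2) 1 (of_real c)" for c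
      by (simp add: r_mat_def a_def)
    have "C p a = 0"
      unfolding C_def r mat22_eq_iff matrix_mult_nth2 mat22_nth zero_index of_real_minus
      using k0 by (intro conjI) algebra+
    then show ?thesis by simp
  qed
  have C_holo: "(\<lambda>l. C p l $ i $ j) holomorphic_on UNIV" if "p \<in> \<Omega>" for p i j
  proof -
    note E_holo = extended_frame_D(4)[OF frame that]
    have r: "(\<lambda>l. r_mat c k l $ i $ j) holomorphic_on UNIV" for c i j
      using exhaust_2[of i] exhaust_2[of j] by (auto simp: r_mat_def intro!: holomorphic_intros)
    show ?thesis
      unfolding C_def matrix_mult_nth2 by (intro holomorphic_intros r E_holo)
  qed
  have F_holo: "(\<lambda>l. F p l $ i $ j) holomorphic_on UNIV" if "p \<in> \<Omega>" for p i j
    by (rule pole_theorem_open_0[OF C_holo[OF that, of i j] open_UNIV, of a])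
      (simp_all add: F_def C_zero[OF that])

  define \<mu> where "\<mu> = (\<lambda>n. a + 1 / of_nat (Suc n))"
  have \<mu>_ne: "\<mu> n \<noteq> a" for n
    by (simp add: \<mu>_def del: of_nat_Suc)
  have \<mu>_lim: "\<mu> \<longlonglongrightarrow> a"
    using tendsto_add[OF tendsto_const[of a] lim_1_over_n[THEN LIMSEQ_Suc]] by (simp add: \<mu>_def)
  have F_lim: "(\<lambda>n. F p (\<mu> n) $ i $ j) \<longlonglongrightarrow> F p a $ i $ j" if "p \<in> \<Omega>" for p i j
    by (rule continuous_on_tendsto_compose[OF holomorphic_on_imp_continuous_on[OF F_holo[OF that]] \<mu>_lim]) auto

  \<comment> \<open>The scalar factor is written as a matrix so that only a constant left factor and the gauge
    matrix remain around \<open>E\<close>.\<close>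
  have F_prod: "F p l = (mat22 (1 / (l - a)) 0 0 (1 / (l - a)) ** r_mat \<xi> k l) ** (E p l ** r_mat (- X p) k l)"
    if "l \<noteq> a" for p l
  proof -
    have "F p l = mat22 (1 / (l - a)) 0 0 (1 / (l - a)) ** C p l"
      using that by (simp add: F_def mat22_eq_iff matrix_mult_nth2)
    then show ?thesis by (simp add: C_def matrix_mul_assoc)
  qed

  have F_x_off: "((\<lambda>s. F (s, t) l) has_vector_derivative F (x, t) l ** lax_x Q (x, t) l) (at x)"
    and F_t_off: "((\<lambda>s. F (x, s) l) has_vector_derivative F (x, t) l ** lax_t Q (x, t) l) (at t)"
    if xt: "(x, t) \<in> \<Omega>" and l: "l \<noteq> a" for x t l
  proof -
    let ?p = "(x, t)"
    let ?R = "\<lambda>p. r_mat (- X p) k l"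
    let ?G = "mat22 (1 / (l - a)) 0 0 (1 / (l - a)) ** r_mat \<xi> k l"
    note E_der = smooth_on_has_derivative[OF extended_frame_D(2)[OF frame] xt, of l]
    have Ex: "((\<lambda>s. E (s, t) l) has_vector_derivative E ?p l ** lax_x q ?p l) (at x)"
      using ddx_eq(2)[OF E_der] extended_frame_D(6)[OF frame xt, of l] by simp
    have Et: "((\<lambda>s. E (x, s) l) has_vector_derivative E ?p l ** lax_t q ?p l) (at t)"
      using ddt_eq(2)[OF E_der] extended_frame_D(7)[OF frame xt, of l] by simp
    note X_x = smooth_on_DERIV_x[OF X xt, simplified] and X_t = smooth_on_DERIV_t[OF X xt, simplified]
    have Rx: "((\<lambda>s. ?R (s, t)) has_vector_derivative
        ddx X ?p *\<^sub>R mat22 (- 1) 0 0 (- 1) + (2 * X ?p * ddx X ?p) *\<^sub>R mat22 0 1 0 0) (at x)"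
      unfolding gauge_matrix_decomposition by (auto intro!: derivative_eq_intros X_x)
    have Rt: "((\<lambda>s. ?R (x, s)) has_vector_derivative
        ddt X ?p *\<^sub>R mat22 (- 1) 0 0 (- 1) + (2 * X ?p * ddt X ?p) *\<^sub>R mat22 0 1 0 0) (at t)"
      unfolding gauge_matrix_decomposition by (auto intro!: derivative_eq_intros X_t)
    note prod = bounded_bilinear.has_vector_derivative[OF bounded_bilinear_matrix_mult]
    note const = bounded_linear.has_vector_derivative[OF bounded_bilinear.bounded_linear_right[OF bounded_bilinear_matrix_mult]]
    have id_x: "lax_x q ?p l ** ?R ?p + (ddx X ?p *\<^sub>R mat22 (- 1) 0 0 (- 1) + (2 * X ?p * ddx X ?p) *\<^sub>R mat22 0 1 0 0)
        = ?R ?p ** lax_x Q ?p l"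
      unfolding Q_def by (rule gauge_identities(1)[OF \<Omega> kdv ric xt])
    have id_t: "lax_t q ?p l ** ?R ?p + (ddt X ?p *\<^sub>R mat22 (- 1) 0 0 (- 1) + (2 * X ?p * ddt X ?p) *\<^sub>R mat22 0 1 0 0)
        = ?R ?p ** lax_t Q ?p l"
      unfolding Q_def by (rule gauge_identities(2)[OF \<Omega> kdv ric xt])
    show "((\<lambda>s. F (s, t) l) has_vector_derivative F ?p l ** lax_x Q ?p l) (at x)"
    proof -
      have "((\<lambda>s. ?G ** (E (s, t) l ** ?R (s, t))) has_vector_derivative
          ?G ** (E ?p l ** (ddx X ?p *\<^sub>R mat22 (- 1) 0 0 (- 1) + (2 * X ?p * ddx X ?p) *\<^sub>R mat22 0 1 0 0)
            + E ?p l ** lax_x q ?p l ** ?R ?p)) (at x)"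
        by (intro const prod Ex Rx)
      moreover have "E ?p l ** (ddx X ?p *\<^sub>R mat22 (- 1) 0 0 (- 1) + (2 * X ?p * ddx X ?p) *\<^sub>R mat22 0 1 0 0)
            + E ?p l ** lax_x q ?p l ** ?R ?p = E ?p l ** (?R ?p ** lax_x Q ?p l)"
        unfolding id_x[symmetric] by (simp only: matrix_add_ldistrib matrix_mul_assoc add.commute)
      ultimately show ?thesis
        unfolding F_prod[OF l] by (simp only: matrix_mul_assoc)
    qed
    show "((\<lambda>s. F (x, s) l) has_vector_derivative F ?p l ** lax_t Q ?p l) (at t)"
    proof -
      have "((\<lambda>s. ?G ** (E (x, s) l ** ?R (x, s))) has_vector_derivative
          ?G ** (E ?p l ** (ddt X ?p *\<^sub>R mat22 (- 1) 0 0 (- 1) + (2 * X ?p * ddt X ?p) *\<^sub>R mat22 0 1 0 0)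
            + E ?p l ** lax_t q ?p l ** ?R ?p)) (at t)"
        by (intro const prod Et Rt)
      moreover have "E ?p l ** (ddt X ?p *\<^sub>R mat22 (- 1) 0 0 (- 1) + (2 * X ?p * ddt X ?p) *\<^sub>R mat22 0 1 0 0)
            + E ?p l ** lax_t q ?p l ** ?R ?p = E ?p l ** (?R ?p ** lax_t Q ?p l)"
        unfolding id_t[symmetric] by (simp only: matrix_add_ldistrib matrix_mul_assoc add.commute)
      ultimately show ?thesis
        unfolding F_prod[OF l] by (simp only: matrix_mul_assoc)
    qed
  qed

  have F_x_at: "((\<lambda>s. F (s, t) a) has_vector_derivative F (x, t) a ** lax_x Q (x, t) a) (at x)"
    if xt: "(x, t) \<in> \<Omega>" for x t
  proof (rule linear_system_limit[where I="(\<lambda>s. (s, t)) -` \<Omega>" and \<mu>=\<mu> and F="\<lambda>l s. F (s, t) l"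
        and B="\<lambda>l s. lax_x Q (s, t) l"])
    show "open ((\<lambda>s. (s, t)) -` \<Omega>)"
      by (intro open_vimage \<Omega> continuous_intros)
    show "continuous_on (UNIV \<times> (\<lambda>s. (s, t)) -` \<Omega>) (\<lambda>z. lax_x Q (snd z, t) (fst z))"
      by (rule lax_continuous(1)[OF \<Omega> Q, where c="\<lambda>s. (s, t)"]) (auto intro!: continuous_intros)
  qed (use xt F_x_off \<mu>_ne \<mu>_lim F_lim in \<open>auto intro!: vec_tendstoI\<close>)
  have F_t_at: "((\<lambda>s. F (x, s) a) has_vector_derivative F (x, t) a ** lax_t Q (x, t) a) (at t)"
    if xt: "(x, t) \<in> \<Omega>" for x t
  proof (rule linear_system_limit[where I="(\<lambda>s. (x, s)) -` \<Omega>" and \<mu>=\<mu> and F="\<lambda>l s. F (x, s) l"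
        and B="\<lambda>l s. lax_t Q (x, s) l"])
    show "open ((\<lambda>s. (x, s)) -` \<Omega>)"
      by (intro open_vimage \<Omega> continuous_intros)
    show "continuous_on (UNIV \<times> (\<lambda>s. (x, s)) -` \<Omega>) (\<lambda>z. lax_t Q (x, snd z) (fst z))"
      by (rule lax_continuous(2)[OF \<Omega> Q, where c="\<lambda>s. (x, s)"]) (auto intro!: continuous_intros)
  qed (use xt F_t_off \<mu>_ne \<mu>_lim F_lim in \<open>auto intro!: vec_tendstoI\<close>)

  have F_x: "((\<lambda>s. F (s, t) l) has_vector_derivative F (x, t) l ** lax_x Q (x, t) l) (at x)"
    and F_t: "((\<lambda>s. F (x, s) l) has_vector_derivative F (x, t) l ** lax_t Q (x, t) l) (at t)"
    if "(x, t) \<in> \<Omega>" for x t l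
    using F_x_off F_t_off F_x_at F_t_at that by (cases "l = a"; blast)+
  have F_smooth: "smooth_on \<Omega> (\<lambda>p. F p l)" for l
    by (rule linear_system_smooth[OF \<Omega> lax_smooth(1)[OF \<Omega> Q] lax_smooth(2)[OF \<Omega> Q] F_x F_t])
  have F_ddx: "ddx (\<lambda>p. F p l) p = F p l ** lax_x Q p l"
    and F_ddt: "ddt (\<lambda>p. F p l) p = F p l ** lax_t Q p l" if "p \<in> \<Omega>" for p l
    using that F_x[of "fst p" "snd p" l] F_t[of "fst p" "snd p" l]
    by (simp_all add: ddx_def ddt_def vector_derivative_at)

  have F_det_off: "det (F p l) = 1" if "p \<in> \<Omega>" "l \<noteq> a" for p l
  proof -
    have r: "det (r_mat c k l) = a - l" for c
      by (simp add: det_2 r_mat_def a_def power2_eq_square)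
    have s: "det (mat22 (1 / (l - a)) 0 0 (1 / (l - a))) = 1 / (l - a) ^ 2"
      by (simp add: det_2 power2_eq_square)
    have "det (F p l) = (a - l) * (a - l) / (l - a) ^ 2"
      unfolding F_prod[OF that(2)] det_mul r s extended_frame_D(3)[OF frame that(1)] by simp
    also have "(a - l) * (a - l) = (l - a) ^ 2"
      by algebra
    finally show ?thesis
      using that(2) by simp
  qed
  have F_det: "det (F p l) = 1" if p: "p \<in> \<Omega>" for p l
  proof (cases "l = a")
    case True
    have "(\<lambda>n. det (F p (\<mu> n))) \<longlonglongrightarrow> det (F p a)"
      unfolding det_2 by (intro tendsto_intros F_lim p)
    then show ?thesis
      using F_det_off[OF p \<mu>_ne] True by (simp add: LIMSEQ_const_iff)
  qed (use F_det_off p in blast)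
  have F_cnj_off: "cnj (F p (cnj l) $ i $ j) = F p l $ i $ j" if "p \<in> \<Omega>" "l \<noteq> a" for p l i j
  proof -
    have r: "cnj (r_mat c k (cnj l) $ i $ j) = r_mat c k l $ i $ j" for c i j
      using exhaust_2[of i] exhaust_2[of j] by (auto simp: r_mat_def)
    have "cnj l \<noteq> a"
      using that(2) by (metis a_def complex_cnj_cnj complex_cnj_complex_of_real)
    moreover have "cnj (C p (cnj l) $ i $ j) = C p l $ i $ j"
      unfolding C_def matrix_mult_nth2
      by (simp add: r extended_frame_D(5)[OF frame that(1)])
    ultimately show ?thesis
      using that(2) by (simp add: F_def) (simp add: a_def)
  qed
  have F_cnj: "cnj (F p (cnj l) $ i $ j) = F p l $ i $ j" if p: "p \<in> \<Omega>" for p l i j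
  proof (cases "l = a")
    case True
    have "cnj (\<mu> n) = \<mu> n" for n
      by (simp add: \<mu>_def a_def)
    then have "cnj (F p (\<mu> n) $ i $ j) = F p (\<mu> n) $ i $ j" for n
      using F_cnj_off[OF p \<mu>_ne, of n i j] by simp
    then have "(\<lambda>n. F p (\<mu> n) $ i $ j) \<longlonglongrightarrow> cnj (F p a $ i $ j)"
      using tendsto_cnj[OF F_lim[OF p, of i j]] by simp
    then have "cnj (F p a $ i $ j) = F p a $ i $ j"
      using F_lim[OF p] LIMSEQ_unique by blast
    then show ?thesis
      using True by (simp add: a_def)
  qed (use F_cnj_off p in blast)

  have "extended_frame_on \<Omega> Q F"
    unfolding extended_frame_on_def
    using Q_kdv F_smooth F_det F_holo F_cnj F_ddx F_ddt by blast
  moreover have "F p l = (\<chi> i j. C p l $ i $ j / (l - a))" if "l \<noteq> a" for p l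
    using that by (simp add: F_def)
  ultimately show ?thesis
    unfolding Q_def C_def a_def by blast
qed

theorem theorem3p7:
  fixes \<gamma> :: "real \<times> real \<Rightarrow> real ^ 2"
    and q :: "real \<times> real \<Rightarrow> real"
    and E :: "real \<times> real \<Rightarrow> complex \<Rightarrow> complex ^ 2 ^ 2"
    and k \<xi> :: real
    and y :: "real \<times> real \<Rightarrow> complex ^ 2"
    and \<Omega> :: "(real \<times> real) set"
  assumes flow: "central_affine_curve_flow_on UNIV \<gamma> q"
    and frame: "extended_frame_on UNIV q E"
    and init: "E (0, 0) 0 = complexify (col_mat (\<gamma> (0, 0)) (ddx \<gamma> (0, 0)))"
    and k: "k \<noteq> 0"
    and y_def: "\<And>p. y p = matrix_inv (E p (complex_of_real (k ^ 2))) *v vector [- complex_of_real \<xi>, 1]"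
    and \<Omega>: "open \<Omega>"
    and y2: "\<And>p. p \<in> \<Omega> \<Longrightarrow> y p $ 2 \<noteq> 0"
  shows "\<exists>\<xi>t :: real \<times> real \<Rightarrow> real.
      (\<forall>p\<in>\<Omega>. complex_of_real (\<xi>t p) = - (y p $ 1 / y p $ 2)) \<and>
      central_affine_curve_flow_on \<Omega>
        (\<lambda>p. (1 / k) *\<^sub>R (\<xi>t p *\<^sub>R \<gamma> p - ddx \<gamma> p))
        (\<lambda>p. - q p + 2 * ((\<xi>t p) ^ 2 - k ^ 2)) \<and>
      (\<exists>Et.
        extended_frame_on \<Omega> (\<lambda>p. - q p + 2 * ((\<xi>t p) ^ 2 - k ^ 2)) Et \<and>
        (\<forall>p\<in>\<Omega>. \<forall>l. l \<noteq> complex_of_real (k ^ 2) \<longrightarrow>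
           Et p l = (\<chi> i j. (r_mat \<xi> k l ** E p l ** r_mat (- \<xi>t p) k l) $ i $ j
                              / (l - complex_of_real (k ^ 2)))))"
proof -
  have "\<forall>p\<in>\<Omega>. y p $ 2 \<noteq> 0"
    using y2 by simp
  from riccati_solution[OF frame \<Omega> y_def this]
  obtain X where X: "riccati_system_on \<Omega> q k X \<and>
      (\<forall>p\<in>\<Omega>. complex_of_real (X p) = - (y p $ 1 / y p $ 2)) \<and>
      (\<forall>p\<in>\<Omega>. E p (complex_of_real (k ^ 2)) $ 1 $ 2 + complex_of_real \<xi> * E p (complex_of_real (k ^ 2)) $ 2 $ 2
        = complex_of_real (X p) * (E p (complex_of_real (k ^ 2)) $ 1 $ 1
            + complex_of_real \<xi> * E p (complex_of_real (k ^ 2)) $ 2 $ 1))"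
    by (rule exE)
  note ric = X[THEN conjunct1] and X_y = X[THEN conjunct2, THEN conjunct1]
    and kernel = X[THEN conjunct2, THEN conjunct2]
  have frame': "extended_frame_on \<Omega> q E"
    using frame by (rule extended_frame_on_subset) simp
  have "central_affine_curve_flow_on \<Omega> (\<lambda>p. (1 / k) *\<^sub>R (X p *\<^sub>R \<gamma> p - ddx \<gamma> p))
      (\<lambda>p. - q p + 2 * ((X p) ^ 2 - k ^ 2))"
    by (rule transformed_curve[OF \<Omega> flow k extended_frame_D(1)[OF frame'] ric])
  moreover have "\<exists>Et. extended_frame_on \<Omega> (\<lambda>p. - q p + 2 * ((X p) ^ 2 - k ^ 2)) Et \<and>
      (\<forall>p\<in>\<Omega>. \<forall>l. l \<noteq> complex_of_real (k ^ 2) \<longrightarrow>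
        Et p l = (\<chi> i j. (r_mat \<xi> k l ** E p l ** r_mat (- X p) k l) $ i $ j / (l - complex_of_real (k ^ 2))))"
    by (rule transformed_frame[OF \<Omega> frame' ric kernel])
  ultimately show ?thesis
    using X_y by blast
qed

end
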